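(* For each $n\in\mathbb N$ let $E^{(n)}_1,\dots,E^{(n)}_n$ be real numbers that are linearly independent over $\mathbb Q$, and let $d^{(n)}_1,\dots,d^{(n)}_n>0$ be weights (which may depend on $n$). Let $Z_n(t)=\sum_{j=1}^n d^{(n)}_je^{-itE^{(n)}_j}$, $(\Delta Z_n)^2=\sum_{j=1}^n (d_j^{(n)})^2$ and $Y_n(t)=Z_n(t)/\Delta Z_n\in\mathbb C\cong\mathbb R^2$, where $t$ is a random time distributed according to the infinite time average. Suppose the weights satisfy the Lyapunov condition: there exists $q>1$ such that $\lim_{n\to\infty}R_q^n=0$. Then $Y_n$ converges in distribution, as $n\to\infty$, to the standard two-dimensional Gaussian with density $P_Y(\boldsymbol y)=\frac1\pi e^{-\|\boldsymbol y\|^2}$ on $\mathbb R^2$. Conversely, if there is no $q>1$ with $\lim_{n\to\infty}R_q^n=0$, then $Y_n$ does not converge in distribution to this Gaussian.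
   Context: Infinite time average: $\overline{f(t)}:=\lim_{T\to\infty}\frac1T\int_0^Tf(t)\,dt$. "$t$ distributed according to the infinite time average" means that the law of a random variable $F(t)$ is the limit as $T\to\infty$ of the law of $F(t)$ with $t$ uniform on $[0,T]$; equivalently $\overline{g(F(t))}$ is the expectation of $g(F)$ for bounded continuous $g$. For weights $d_1,\dots,d_n$ define $R_q^n:=\dfrac{\sum_{j=1}^n d_j^{2q}}{\left(\sum_{j=1}^n d_j^2\right)^q}$. *)

theory Defs
  imports "HOL-Probability.Probability"
begin

definition has_time_avg :: "(real \<Rightarrow> real) \<Rightarrow> real \<Rightarrow> bool" where
  "has_time_avg f a \<longleftrightarrow> ((\<lambda>T. integral {0..T} f / T) \<longlongrightarrow> a) at_top"

definition conv_dist_time_avg :: "(nat \<Rightarrow> real \<Rightarrow> complex) \<Rightarrow> complex measure \<Rightarrow> bool" where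
  "conv_dist_time_avg Y \<mu> \<longleftrightarrow>
     (\<forall>g :: complex \<Rightarrow> real. continuous_on UNIV g \<and> bounded (range g) \<longrightarrow>
        (\<exists>a :: nat \<Rightarrow> real. (\<forall>n. has_time_avg (\<lambda>t. g (Y n t)) (a n)) \<and>
            a \<longlonglongrightarrow> integral\<^sup>L \<mu> g))"

definition std_gauss2 :: "complex measure" where
  "std_gauss2 = density lborel (\<lambda>y. ennreal (exp (- (cmod y)\<^sup>2) / pi))"

definition R_ratio :: "real \<Rightarrow> nat \<Rightarrow> (nat \<Rightarrow> real) \<Rightarrow> real" where
  "R_ratio q n d = (\<Sum>j=1..n. d j powr (2 * q)) / (\<Sum>j=1..n. (d j)\<^sup>2) powr q"

definition Zsig :: "(nat \<Rightarrow> real) \<Rightarrow> (nat \<Rightarrow> real) \<Rightarrow> nat \<Rightarrow> real \<Rightarrow> complex" where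
  "Zsig d E n t = (\<Sum>j=1..n. complex_of_real (d j) * exp (- \<i> * complex_of_real (t * E j)))"

definition Ysig :: "(nat \<Rightarrow> real) \<Rightarrow> (nat \<Rightarrow> real) \<Rightarrow> nat \<Rightarrow> real \<Rightarrow> complex" where
  "Ysig d E n t = Zsig d E n t / complex_of_real (sqrt (\<Sum>j=1..n. (d j)\<^sup>2))"

end

theory Submission
  imports Defs
begin

text \<open>Time averages of uniformly almost periodic functions define a positive functional, and
  rational independence of the energies makes it multiplicative on the individual phases.  Hence the
  characteristic function of $Y_n$ at $u$ is $\prod_j J_0(a_j |u|)$ with $a_j = d_j / \Delta Z_n$,
  where $J_0(x) = e^{-x^2/4} (1 - x^4/64 + O(x^6))$.  As $\sum_j a_j^2 = 1$, it is close to
  $e^{-|u|^2/4}$ exactly when $R_2^n = \sum_j a_j^4$ is small; and $R_q^n \to 0$ for some $q > 1$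
  forces $\max_j a_j \to 0$ and so $R_2^n \to 0$.  Convergence of characteristic functions passes to
  all almost periodic test functions on the plane, and, by tightness, to bounded continuous ones.\<close>

subsection \<open>Almost periodic functions\<close>

text \<open>The infinite time average is a functional on functions of time, not integration against
  a probability measure on the time line. No laws of the signals are therefore built, and no
  continuity theorem for measures is applied to them: approximation in the supremum norm does the
  work. That every required time average exists is part of the claim; it holds because a continuous
  function of a bounded almost periodic signal is again almost periodic. The frequency set is a
  parameter because independence of two signals is a property of their frequencies, and it has to
  survive nonlinear operations such as the exponential. The converse cannot assume small weights. It
  tests only at \<open>u = 1\<close>, where every Bessel argument is at most 1; there each factor
  has modulus at most its Gaussian counterpart times exp(-a_j^4/128), and such deficits multiply
  without cancelling.\<close>

text \<open>Uniform closure of the trigonometric polynomials with frequencies in \<open>\<Lambda>\<close>.  The domain is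
  generic because time (the real line) and the target plane of the signal are both needed.\<close>

inductive_set ap :: "'a::real_inner set \<Rightarrow> ('a \<Rightarrow> complex) set" for \<Lambda> where
  wave: "u \<in> \<Lambda> \<Longrightarrow> (\<lambda>x. iexp (u \<bullet> x)) \<in> ap \<Lambda>"
| add: "f \<in> ap \<Lambda> \<Longrightarrow> g \<in> ap \<Lambda> \<Longrightarrow> (\<lambda>x. f x + g x) \<in> ap \<Lambda>"
| cmult: "f \<in> ap \<Lambda> \<Longrightarrow> (\<lambda>x. c * f x) \<in> ap \<Lambda>"
| unif: "(\<And>e::real. e > 0 \<Longrightarrow> \<exists>g. g \<in> ap \<Lambda> \<and> (\<forall>x. norm (f x - g x) \<le> e)) \<Longrightarrow> f \<in> ap \<Lambda>"

lemma ap_mono: "f \<in> ap \<Lambda> \<Longrightarrow> \<Lambda> \<subseteq> \<Lambda>' \<Longrightarrow> f \<in> ap \<Lambda>'"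
proof (induction rule: ap.induct)
  case (unif f)
  then show ?case by (intro ap.unif) blast
qed (auto intro: ap.intros)

lemma ap_bounded:
  assumes "f \<in> ap \<Lambda>"
  obtains B where "B > 0" "\<And>x. norm (f x) \<le> B"
proof -
  have "\<exists>B>0. \<forall>x. norm (f x) \<le> B"
    using assms
  proof (induction rule: ap.induct)
    case (wave u)
    show ?case by (intro exI[of _ 1]) auto
  next
    case (add f g)
    then obtain B C where "B > 0" "\<forall>x. norm (f x) \<le> B" "C > 0" "\<forall>x. norm (g x) \<le> C"
      by blast
    then show ?case
      by (intro exI[of _ "B + C"]) (auto intro!: norm_triangle_mono)
  next
    case (cmult f c)
    then obtain B where B: "B > 0" "\<forall>x. norm (f x) \<le> B"
      by blast
    have "norm (c * f x) \<le> norm c * B + 1" for x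
      using mult_left_mono[of "norm (f x)" B "norm c"] B by (simp add: norm_mult)
    moreover have "norm c * B + 1 > 0"
      using B by (simp add: add_nonneg_pos)
    ultimately show ?case
      by blast
  next
    case (unif f)
    from unif[of 1] obtain g B where "B > 0" "\<forall>x. norm (g x) \<le> B" "\<forall>x. norm (f x - g x) \<le> 1"
      by auto
    then show ?case
      by (intro exI[of _ "B + 1"]) (auto intro: order_trans[OF norm_triangle_sub add_mono])
  qed
  then show ?thesis
    using that by blast
qed

lemma ap_continuous: "f \<in> ap \<Lambda> \<Longrightarrow> continuous_on UNIV f"
proof (induction rule: ap.induct)
  case (unif f)
  have "\<exists>g. g \<in> ap \<Lambda> \<and> continuous_on UNIV g \<and> (\<forall>x. norm (f x - g x) \<le> 1 / Suc n)" for n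
    using unif[of "1 / Suc n"] by auto
  then obtain g where g: "\<And>n. continuous_on UNIV (g n)"
      "\<And>n x. norm (f x - g n x) \<le> 1 / Suc n"
    by metis
  have "uniform_limit UNIV g f sequentially"
    unfolding uniform_limit_sequentially_iff
  proof (intro allI impI)
    fix e :: real assume "e > 0"
    then obtain N where N: "inverse (Suc N) < e"
      using reals_Archimedean by blast
    have "dist (g n x) (f x) < e" if "n \<ge> N" for n x
    proof -
      have "dist (g n x) (f x) \<le> 1 / Suc n"
        using g(2)[of x n] by (simp add: dist_norm norm_minus_commute)
      also have "\<dots> \<le> 1 / Suc N"
        using that by (simp add: frac_le)
      finally show ?thesis
        using N by (simp add: inverse_eq_divide)
    qed
    then show "\<exists>N. \<forall>n\<ge>N. \<forall>x\<in>UNIV. dist (g n x) (f x) < e"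
      by blast
  qed
  then show ?case
    by (rule uniform_limit_theorem[rotated]) (auto simp: g)
qed (auto intro!: continuous_intros)

text \<open>Products of waves add frequencies, hence the closure condition on \<Lambda>. Uniform
  errors survive multiplication because the other factor is bounded: a wave has norm 1, and a
  general \<open>g\<close> is bounded by \<open>ap_bounded\<close>.\<close>

lemma ap_mult:
  assumes f: "f \<in> ap \<Lambda>" and g: "g \<in> ap \<Lambda>" and \<Lambda>: "\<And>u v. u \<in> \<Lambda> \<Longrightarrow> v \<in> \<Lambda> \<Longrightarrow> u + v \<in> \<Lambda>"
  shows "(\<lambda>x. f x * g x) \<in> ap \<Lambda>"
  using f
proof (induction rule: ap.induct)
  case (wave u)
  show ?case
    using g
  proof (induction rule: ap.induct)
    case (wave v)
    show ?case
      using ap.wave[OF \<Lambda>[OF \<open>u \<in> \<Lambda>\<close> wave]]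
      by (simp add: inner_add_left distrib_left exp_add)
  next
    case (add f g)
    then show ?case by (simp add: distrib_left ap.add)
  next
    case (cmult f c)
    then show ?case
      using ap.cmult[of "\<lambda>x. iexp (u \<bullet> x) * f x" \<Lambda> c] by (simp add: mult_ac)
  next
    case (unif f)
    show ?case
    proof (rule ap.unif)
      fix e :: real assume "e > 0"
      from unif[OF this] obtain g where
        "(\<lambda>x. iexp (u \<bullet> x) * g x) \<in> ap \<Lambda>" "\<forall>x. norm (f x - g x) \<le> e"
        by blast
      then show "\<exists>g. g \<in> ap \<Lambda> \<and> (\<forall>x. norm (iexp (u \<bullet> x) * f x - g x) \<le> e)"
        by (intro exI[of _ "\<lambda>x. iexp (u \<bullet> x) * g x"])
           (auto simp: right_diff_distrib[symmetric] norm_mult)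
    qed
  qed
next
  case (add f g)
  then show ?case by (simp add: distrib_right ap.add)
next
  case (cmult f c)
  then show ?case by (simp add: mult.assoc ap.cmult)
next
  case (unif f)
  obtain B where B: "B > 0" "\<And>x. norm (g x) \<le> B"
    using ap_bounded[OF g] by blast
  show ?case
  proof (rule ap.unif)
    fix e :: real assume "e > 0"
    then have "e / B > 0"
      using B by simp
    from unif[OF this] obtain h where
      h: "(\<lambda>x. h x * g x) \<in> ap \<Lambda>" "\<And>x. norm (f x - h x) \<le> e / B"
      by blast
    have "norm (f x * g x - h x * g x) \<le> e" for x
    proof -
      have "norm (f x * g x - h x * g x) = norm (f x - h x) * norm (g x)"
        by (simp add: left_diff_distrib[symmetric] norm_mult)
      also have "\<dots> \<le> e / B * B"
        using h(2)[of x] B \<open>e > 0\<close> by (intro mult_mono) auto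
      finally show ?thesis
        using B by simp
    qed
    with h(1) show "\<exists>h. h \<in> ap \<Lambda> \<and> (\<forall>x. norm (f x * g x - h x) \<le> e)"
      by blast
  qed
qed

lemma ap_cnj:
  assumes "f \<in> ap \<Lambda>" "\<And>u. u \<in> \<Lambda> \<Longrightarrow> - u \<in> \<Lambda>"
  shows "(\<lambda>x. cnj (f x)) \<in> ap \<Lambda>"
  using assms(1)
proof (induction rule: ap.induct)
  case (wave u)
  show ?case
    using ap.wave[OF assms(2)[OF wave]] by (simp add: exp_cnj)
next
  case (unif f)
  show ?case
  proof (rule ap.unif)
    fix e :: real assume "e > 0"
    from unif[OF this] obtain g where "(\<lambda>x. cnj (g x)) \<in> ap \<Lambda>" "\<forall>x. norm (f x - g x) \<le> e"
      by blast
    then show "\<exists>g. g \<in> ap \<Lambda> \<and> (\<forall>x. norm (cnj (f x) - g x) \<le> e)"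
      by (intro exI[of _ "\<lambda>x. cnj (g x)"]) (auto simp flip: complex_cnj_diff)
  qed
qed (auto intro: ap.intros)

lemma ap_const: "0 \<in> \<Lambda> \<Longrightarrow> (\<lambda>x. c) \<in> ap \<Lambda>"
  using ap.cmult[OF ap.wave[of 0 \<Lambda>], of c] by simp

lemma ap_sum: "0 \<in> \<Lambda> \<Longrightarrow> (\<And>i. i \<in> I \<Longrightarrow> f i \<in> ap \<Lambda>) \<Longrightarrow> (\<lambda>x. \<Sum>i\<in>I. f i x) \<in> ap \<Lambda>"
  by (induction I rule: infinite_finite_induct) (auto intro: ap.add ap_const)

lemma ap_power:
  assumes "0 \<in> \<Lambda>" "f \<in> ap \<Lambda>" "\<And>u v. u \<in> \<Lambda> \<Longrightarrow> v \<in> \<Lambda> \<Longrightarrow> u + v \<in> \<Lambda>"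
  shows "(\<lambda>x. f x ^ n) \<in> ap \<Lambda>"
  by (induction n) (auto intro: ap_mult ap_const assms)

lemma ap_Re_Im:
  assumes f: "f \<in> ap \<Lambda>" and \<Lambda>: "\<And>u. u \<in> \<Lambda> \<Longrightarrow> - u \<in> \<Lambda>"
  shows "(\<lambda>x. complex_of_real (Re (f x))) \<in> ap \<Lambda>" "(\<lambda>x. complex_of_real (Im (f x))) \<in> ap \<Lambda>"
proof -
  have "(\<lambda>x. 1/2 * f x + 1/2 * cnj (f x)) \<in> ap \<Lambda>"
    by (intro ap.add ap.cmult ap_cnj f \<Lambda>)
  also have "(\<lambda>x. 1/2 * f x + 1/2 * cnj (f x)) = (\<lambda>x. complex_of_real (Re (f x)))"
    by (auto simp: complex_eq_iff)
  finally show "(\<lambda>x. complex_of_real (Re (f x))) \<in> ap \<Lambda>" .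
  have "(\<lambda>x. - \<i>/2 * f x + \<i>/2 * cnj (f x)) \<in> ap \<Lambda>"
    by (intro ap.add ap.cmult ap_cnj f \<Lambda>)
  also have "(\<lambda>x. - \<i>/2 * f x + \<i>/2 * cnj (f x)) = (\<lambda>x. complex_of_real (Im (f x)))"
    by (auto simp: complex_eq_iff)
  finally show "(\<lambda>x. complex_of_real (Im (f x))) \<in> ap \<Lambda>" .
qed

text \<open>Stone-Weierstrass replaces \<open>G\<close> by a real polynomial in Re and Im, and an
  additive group of frequencies makes the class an algebra closed under conjugation. Continuity is
  asked only on a compact set containing the range, so that functions such as arcsin can be composed
  as well.\<close>

lemma ap_compose:
  fixes G :: "complex \<Rightarrow> real"
  assumes \<Lambda>: "0 \<in> \<Lambda>" "\<And>u. u \<in> \<Lambda> \<Longrightarrow> - u \<in> \<Lambda>" "\<And>u v. u \<in> \<Lambda> \<Longrightarrow> v \<in> \<Lambda> \<Longrightarrow> u + v \<in> \<Lambda>"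
    and f: "f \<in> ap \<Lambda>" and K: "compact K" "range f \<subseteq> K" and G: "continuous_on K G"
  shows "(\<lambda>x. complex_of_real (G (f x))) \<in> ap \<Lambda>"
proof (rule ap.unif)
  fix e :: real assume "e > 0"
  obtain p where p: "real_polynomial_function p" "\<And>z. z \<in> K \<Longrightarrow> \<bar>G z - p z\<bar> < e"
    using Stone_Weierstrass_real_polynomial_function[OF K(1) G \<open>e > 0\<close>] by blast
  from p(1) have "(\<lambda>x. complex_of_real (p (f x))) \<in> ap \<Lambda>"
  proof (induction rule: real_polynomial_function.induct)
    case (linear h)
    interpret bounded_linear h by fact
    have "h z = h 1 * Re z + h \<i> * Im z" for z
    proof -
      have "z = Re z *\<^sub>R 1 + Im z *\<^sub>R \<i>"
        by (simp add: complex_eq_iff)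
      then show ?thesis
        by (metis add scaleR real_scaleR_def mult.commute)
    qed
    then have "(\<lambda>x. complex_of_real (h (f x))) =
        (\<lambda>x. complex_of_real (h 1) * complex_of_real (Re (f x)) +
             complex_of_real (h \<i>) * complex_of_real (Im (f x)))"
      by (metis of_real_add of_real_mult)
    then show ?case
      by (simp only:) (intro ap.add ap.cmult ap_Re_Im f \<Lambda>)
  qed (auto intro: ap_const ap.add ap_mult \<Lambda>)
  moreover have "norm (complex_of_real (G (f x)) - complex_of_real (p (f x))) \<le> e" for x
  proof -
    have "\<bar>G (f x) - p (f x)\<bar> < e"
      using p(2) K(2) by auto
    then show ?thesis
      by (simp only: of_real_diff[symmetric] norm_of_real)
  qed
  ultimately show "\<exists>g. g \<in> ap \<Lambda> \<and> (\<forall>x. norm (complex_of_real (G (f x)) - g x) \<le> e)"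
    by (intro exI[of _ "\<lambda>x. complex_of_real (p (f x))"]) auto
qed

subsection \<open>Time averages\<close>

definition avg :: "(real \<Rightarrow> complex) \<Rightarrow> real \<Rightarrow> complex" where
  "avg f T = integral {0..T} f /\<^sub>R T"

text \<open>\<open>Lim\<close> is total, so this denotes the time average only where the averages
  converge; almost periodicity guarantees that.\<close>

definition mean :: "(real \<Rightarrow> complex) \<Rightarrow> complex" where
  "mean f = Lim at_top (avg f)"

lemma avg_add:
  "continuous_on UNIV f \<Longrightarrow> continuous_on UNIV g \<Longrightarrow> avg (\<lambda>x. f x + g x) T = avg f T + avg g T"
  unfolding avg_def
  by (subst integral_add) (auto intro!: integrable_continuous_real intro: continuous_on_subset simp: scaleR_add_right)

lemma avg_cmult: "avg (\<lambda>x. c * f x) T = c * avg f T"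
  by (simp add: avg_def)

lemma avg_dist_le:
  assumes "continuous_on UNIV f" "continuous_on UNIV g" "\<And>x. norm (f x - g x) \<le> e" "T > 0"
  shows "norm (avg f T - avg g T) \<le> e"
proof -
  have int: "f integrable_on {0..T}" "g integrable_on {0..T}"
    using assms by (auto intro!: integrable_continuous_real intro: continuous_on_subset)
  have "norm (avg f T - avg g T) = norm (integral {0..T} (\<lambda>x. f x - g x)) / T"
    using assms int by (simp add: avg_def integral_diff scaleR_diff_right[symmetric] divide_inverse mult.commute)
  also have "norm (integral {0..T} (\<lambda>x. f x - g x)) \<le> e * (T - 0)"
    using assms by (intro integral_bound) (auto intro!: continuous_intros intro: continuous_on_subset)
  finally show ?thesis
    using assms by (simp add: divide_right_mono)
qed

text \<open>An oscillating wave has a bounded primitive, so its integral over \<open>{0..T}\<close>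
  stays below 2/|u| and dividing by T kills it. Only the zero frequency is seen by the mean.\<close>

lemma avg_wave:
  "(avg (\<lambda>x. iexp (u * x)) \<longlongrightarrow> (if u = 0 then 1 else 0)) at_top"
proof (cases "u = 0")
  case True
  have "eventually (\<lambda>T. avg (\<lambda>x. iexp (u * x)) T = 1) at_top"
    using eventually_gt_at_top[of 0]
    by eventually_elim (simp add: avg_def True scaleR_conv_of_real)
  then show ?thesis
    using True by (auto intro: tendsto_eventually)
next
  case False
  have *: "norm (avg (\<lambda>x. iexp (u * x)) T) \<le> (2 / \<bar>u\<bar>) / T" if "T > 0" for T
  proof -
    have "((\<lambda>x. iexp (u * x) / (\<i> * u)) has_vector_derivative iexp (u * x)) (at x within {0..T})" for x
    proof -
      have "((\<lambda>z. exp (\<i> * (u * z)) / (\<i> * u)) has_field_derivative iexp (u * x)) (at (complex_of_real x))"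
        using False by (auto intro!: derivative_eq_intros simp: mult_ac)
      from has_vector_derivative_real_field[OF this] show ?thesis
        by simp
    qed
    then have "((\<lambda>x. iexp (u * x)) has_integral
        (iexp (u * T) / (\<i> * u) - iexp (u * 0) / (\<i> * u))) {0..T}"
      using that by (intro fundamental_theorem_of_calculus) auto
    then have "integral {0..T} (\<lambda>x. iexp (u * x)) = (iexp (u * T) - 1) / (\<i> * u)"
      by (auto simp: diff_divide_distrib dest: integral_unique)
    moreover have "norm (iexp (u * T) - 1) \<le> 2"
      using norm_triangle_ineq4[of "iexp (u * T)" 1] by simp
    ultimately have "norm (avg (\<lambda>x. iexp (u * x)) T) = norm (iexp (u * T) - 1) / \<bar>u\<bar> / T"
      using that by (simp add: avg_def norm_divide norm_mult divide_inverse norm_inverse)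
    then show ?thesis
      using \<open>norm (iexp (u * T) - 1) \<le> 2\<close> that by (simp add: divide_right_mono)
  qed
  have bound: "\<forall>\<^sub>F T in at_top. norm (avg (\<lambda>x. iexp (u * x)) T) \<le> (2 / \<bar>u\<bar>) / T"
    using eventually_gt_at_top[of 0] by eventually_elim (rule *)
  have "((\<lambda>T. (2 / \<bar>u\<bar>) / T) \<longlongrightarrow> 0) at_top"
    by (intro tendsto_divide_0[OF tendsto_const] filterlim_mono[OF filterlim_ident]) (auto simp: at_top_le_at_infinity)
  then have "(avg (\<lambda>x. iexp (u * x)) \<longlongrightarrow> 0) at_top"
    by (rule Lim_null_comparison[OF bound])
  then show ?thesis
    using False by simp
qed

lemma avg_convergent: "f \<in> ap \<Lambda> \<Longrightarrow> \<exists>l. (avg f \<longlongrightarrow> l) at_top"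
proof (induction rule: ap.induct)
  case (wave u)
  show ?case
    using avg_wave[of u] by auto
next
  case (add f g)
  then obtain l m where "(avg f \<longlongrightarrow> l) at_top" "(avg g \<longlongrightarrow> m) at_top"
    by blast
  moreover have "avg (\<lambda>x. f x + g x) = (\<lambda>T. avg f T + avg g T)"
    using avg_add add ap_continuous by blast
  ultimately show ?case
    by (auto intro: tendsto_add)
next
  case (cmult f c)
  moreover have "avg (\<lambda>x. c * f x) = (\<lambda>T. c * avg f T)"
    using avg_cmult by blast
  ultimately show ?case
    by (auto intro: tendsto_mult_left)
next
  case (unif f)
  have f: "f \<in> ap \<Lambda>"
    by (rule ap.unif) (use unif in blast)
  \<comment> \<open>A uniform approximation within e/4 moves every average by at most e/4, whatever
    T is. Two such moves and two distances to the limit for \<open>g\<close> add up to less than e;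
    the Cauchy filter form is used because T runs through the reals.\<close>
  have "cauchy_filter (filtermap (avg f) at_top)"
    unfolding cauchy_filter_metric_filtermap
  proof (intro allI impI)
    fix e :: real assume "e > 0"
    then obtain g l where g: "g \<in> ap \<Lambda>" "(avg g \<longlongrightarrow> l) at_top" "\<And>x. norm (f x - g x) \<le> e / 4"
      using unif[of "e/4"] by auto
    have "eventually (\<lambda>T. dist (avg g T) l < e / 4) at_top"
      using g(2) \<open>e > 0\<close> by (intro tendstoD) auto
    then have ev: "eventually (\<lambda>T. T > 0 \<and> dist (avg g T) l < e / 4) at_top"
      using eventually_gt_at_top[of 0] by eventually_elim auto
    show "\<exists>P. eventually P at_top \<and> (\<forall>x y. P x \<and> P y \<longrightarrow> dist (avg f x) (avg f y) < e)"
    proof (intro exI conjI allI impI)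
      show "eventually (\<lambda>T. T > 0 \<and> dist (avg g T) l < e / 4) at_top"
        by (rule ev)
      fix S T assume ST: "(S > 0 \<and> dist (avg g S) l < e / 4) \<and> (T > 0 \<and> dist (avg g T) l < e / 4)"
      have "dist (avg f T) (avg g T) \<le> e / 4" if "T > 0" for T
        unfolding dist_norm by (intro avg_dist_le ap_continuous[OF f] ap_continuous[OF g(1)] g that)
      then have "dist (avg f T) (avg g T) \<le> e / 4" "dist (avg f S) (avg g S) \<le> e / 4"
        using ST by auto
      then show "dist (avg f S) (avg f T) < e"
        using ST dist_triangle[of "avg f S" "avg f T" "avg g S"]
          dist_triangle[of "avg g S" "avg f T" "avg g T"] dist_triangle[of "avg g S" "avg g T" l]
        by (simp add: dist_commute)
    qed
  qed
  then have "\<exists>l. filtermap (avg f) at_top \<le> nhds l"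
    using complete_UNIV complete_uniform by (metis filtermap_bot_iff trivial_limit_at_top_linorder top_greatest UNIV_I principal_UNIV)
  then show ?case
    by (auto simp: filterlim_def)
qed

lemma avg_tendsto_mean: "f \<in> ap \<Lambda> \<Longrightarrow> (avg f \<longlongrightarrow> mean f) at_top"
  unfolding mean_def using avg_convergent tendsto_Lim[OF trivial_limit_at_top_linorder] by metis

lemma mean_eqI: "(avg f \<longlongrightarrow> l) at_top \<Longrightarrow> mean f = l"
  unfolding mean_def using tendsto_Lim[OF trivial_limit_at_top_linorder] by metis

lemma mean_wave: "mean (\<lambda>x. iexp (u * x)) = (if u = 0 then 1 else 0)"
  by (rule mean_eqI[OF avg_wave])

lemma mean_const: "mean (\<lambda>x. c) = c"
  using tendsto_mult_left[OF avg_wave[of 0], of c]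
  by (intro mean_eqI) (simp add: avg_cmult flip: avg_cmult)

lemma mean_add:
  assumes "f \<in> ap \<Lambda>" "g \<in> ap \<Lambda>'"
  shows "mean (\<lambda>x. f x + g x) = mean f + mean g"
  using tendsto_add[OF avg_tendsto_mean[OF assms(1)] avg_tendsto_mean[OF assms(2)]]
  by (intro mean_eqI) (simp flip: avg_add[OF ap_continuous[OF assms(1)] ap_continuous[OF assms(2)]])

lemma mean_cmult:
  assumes "f \<in> ap \<Lambda>"
  shows "mean (\<lambda>x. c * f x) = c * mean f"
  using avg_tendsto_mean[OF assms]
  by (intro mean_eqI) (auto simp: avg_cmult[abs_def] intro: tendsto_mult_left)

lemma mean_diff:
  assumes "f \<in> ap \<Lambda>" "g \<in> ap \<Lambda>"
  shows "mean (\<lambda>x. f x - g x) = mean f - mean g"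
  using mean_add[OF assms(1) ap.cmult[OF assms(2), of "-1"]] mean_cmult[OF assms(2), of "-1"] by simp

lemma mean_sum:
  assumes "\<And>i. i \<in> I \<Longrightarrow> f i \<in> ap UNIV"
  shows "mean (\<lambda>x. \<Sum>i\<in>I. f i x) = (\<Sum>i\<in>I. mean (f i))"
  using assms
  by (induction I rule: infinite_finite_induct) (simp_all add: mean_const mean_add[of _ UNIV _ UNIV] ap_sum)

lemma mean_dist_le:
  assumes "f \<in> ap \<Lambda>" "g \<in> ap \<Lambda>'" "\<And>x. norm (f x - g x) \<le> e"
  shows "norm (mean f - mean g) \<le> e"
proof (rule tendsto_le[OF _ tendsto_const tendsto_norm[OF tendsto_diff]])
  show "(avg f \<longlongrightarrow> mean f) at_top" "(avg g \<longlongrightarrow> mean g) at_top"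
    using assms avg_tendsto_mean by auto
  show "eventually (\<lambda>T. norm (avg f T - avg g T) \<le> e) at_top"
    using eventually_gt_at_top[of 0]
    by eventually_elim (use assms in \<open>auto intro!: avg_dist_le ap_continuous\<close>)
qed simp

text \<open>Positivity of the mean in the form used later: a pointwise majorant, such as a Taylor
  remainder or a Chebyshev bound, turns into a bound by a moment.\<close>

lemma mean_norm_le:
  assumes f: "f \<in> ap \<Lambda>" and g: "(\<lambda>x. complex_of_real (g x)) \<in> ap \<Lambda>'" and le: "\<And>x. norm (f x) \<le> g x"
  shows "norm (mean f) \<le> Re (mean (\<lambda>x. complex_of_real (g x)))"
proof (rule tendsto_le[OF _ tendsto_Re[OF avg_tendsto_mean[OF g]] tendsto_norm[OF avg_tendsto_mean[OF f]]])
  have cont: "continuous_on UNIV f" "continuous_on UNIV (\<lambda>x. complex_of_real (g x))"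
    using f g ap_continuous by blast+
  have g': "continuous_on UNIV g"
    using continuous_on_Re[OF cont(2)] by simp
  have int: "f integrable_on {0..T}" "g integrable_on {0..T}" for T
    using cont g' by (auto intro!: integrable_continuous_real intro: continuous_on_subset)
  show "eventually (\<lambda>T. norm (avg f T) \<le> Re (avg (\<lambda>x. complex_of_real (g x)) T)) at_top"
    using eventually_gt_at_top[of 0]
  proof eventually_elim
    case (elim T)
    have "norm (integral {0..T} f) \<le> integral {0..T} g"
      by (intro integral_norm_bound_integral int le)
    moreover have "integral {0..T} (\<lambda>x. complex_of_real (g x)) = complex_of_real (integral {0..T} g)"
      using has_integral_of_real[OF integrable_integral[OF int(2)]] by (rule integral_unique)
    ultimately show ?case
      using elim by (simp add: avg_def divide_right_mono mult_left_mono)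
  qed
qed simp

lemma norm_diff_le_halves:
  fixes x y z :: "'a::real_normed_vector"
  assumes "norm (x - y) \<le> e / 2" "norm (y - z) \<le> e / 2"
  shows "norm (x - z) \<le> e"
  using norm_triangle_ineq[of "x - y" "y - z"] assms by simp

text \<open>On two waves the claim says that u + v = 0 exactly when u = 0 and v = 0, which is
  \<open>indep\<close>. Both sides are bilinear and continuous in the supremum norm, so one
  induction per factor extends it.\<close>

lemma mean_mult_independent:
  assumes f: "f \<in> ap \<Lambda>" and g: "g \<in> ap \<Lambda>'"
    and indep: "\<And>u v. u \<in> \<Lambda> \<Longrightarrow> v \<in> \<Lambda>' \<Longrightarrow> u + v = 0 \<Longrightarrow> u = 0 \<and> v = 0"
  shows "mean (\<lambda>x. f x * g x) = mean f * mean g"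
proof -
  \<comment> \<open>The product has frequencies in neither \<Lambda> nor \<Lambda>'; enlarging both
    sets to \<open>UNIV\<close> is enough for its mean to exist.\<close>
  have mult: "(\<lambda>x. f x * g x) \<in> ap UNIV" if "f \<in> ap A" "g \<in> ap B" for f g :: "real \<Rightarrow> complex" and A B
    by (rule ap_mult) (use that in \<open>auto intro: ap_mono\<close>)
  have wave_right: "mean (\<lambda>x. iexp (u * x) * g x) = mean (\<lambda>x. iexp (u * x)) * mean g"
    if u: "u \<in> \<Lambda>" for u
    using g
  proof (induction rule: ap.induct)
    case (wave v)
    have "(\<lambda>x. iexp (u * x) * iexp (v \<bullet> x)) = (\<lambda>x. iexp ((u + v) * x))"
      by (auto simp: algebra_simps simp flip: exp_add)
    then have "mean (\<lambda>x. iexp (u * x) * iexp (v \<bullet> x)) = (if u + v = 0 then 1 else 0)"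
      by (simp only: mean_wave)
    moreover have "mean (\<lambda>x. iexp (v \<bullet> x)) = (if v = 0 then 1 else 0)"
      by (simp only: inner_real_def mean_wave)
    ultimately show ?case
      using indep[OF u wave] by (auto simp only: mean_wave mult_1_left mult_1_right mult_zero_left mult_zero_right split: if_splits)
  next
    case (add f g)
    then show ?case
      using mean_add[OF mult[OF ap.wave[OF u] add(1)] mult[OF ap.wave[OF u] add(2)]]
      by (simp add: distrib_left mean_add[OF add(1,2)])
  next
    case (cmult f c)
    then show ?case
      using mean_cmult[OF mult[OF ap.wave[OF u] cmult(1)], of c]
      by (simp add: mult.left_commute mean_cmult[OF cmult(1)])
  next
    case (unif f)
    have f: "f \<in> ap \<Lambda>'"
      by (rule ap.unif) (use unif in blast)
    have "norm (mean (\<lambda>x. iexp (u * x) * f x) - mean (\<lambda>x. iexp (u * x)) * mean f) \<le> e" if "e > 0" for e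
    proof -
      obtain g where g: "g \<in> ap \<Lambda>'" "\<And>x. norm (f x - g x) \<le> e/2"
        and eq: "mean (\<lambda>x. iexp (u * x) * g x) = mean (\<lambda>x. iexp (u * x)) * mean g"
        using unif[of "e/2"] \<open>e > 0\<close> by auto
      have "norm (mean (\<lambda>x. iexp (u * x) * f x) - mean (\<lambda>x. iexp (u * x) * g x)) \<le> e/2"
        using mult[OF ap.wave[OF u] f] mult[OF ap.wave[OF u] g(1)]
        by (intro mean_dist_le) (simp_all add: norm_mult g(2)[simplified] flip: right_diff_distrib)
      moreover have "norm (mean (\<lambda>x. iexp (u * x)) * mean g - mean (\<lambda>x. iexp (u * x)) * mean f) \<le> e / 2"
      proof -
        have "norm (mean (\<lambda>x. iexp (u * x))) \<le> 1"
          unfolding mean_wave by simp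
        moreover have "norm (mean g - mean f) \<le> e / 2"
          using mean_dist_le[OF f g(1) g(2)] by (simp add: norm_minus_commute)
        ultimately have "norm (mean (\<lambda>x. iexp (u * x))) * norm (mean g - mean f) \<le> 1 * (e / 2)"
          by (intro mult_mono) auto
        then show ?thesis
          by (simp only: right_diff_distrib[symmetric] norm_mult mult_1_left)
      qed
      ultimately show ?thesis
        unfolding eq by (rule norm_diff_le_halves)
    qed
    then show ?case
      using field_le_epsilon[of "norm (mean (\<lambda>x. iexp (u * x) * f x) - mean (\<lambda>x. iexp (u * x)) * mean f)" 0]
      by auto
  qed
  show ?thesis
    using f
  proof (induction rule: ap.induct)
    case (wave u)
    then show ?case
      using wave_right by simp
  next
    case (add f h)
    then show ?case
      using mean_add[OF mult[OF add(1) g] mult[OF add(2) g]]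
      by (simp add: distrib_right mean_add[OF add(1,2)])
  next
    case (cmult f c)
    then show ?case
      using mean_cmult[OF mult[OF cmult(1) g], of c]
      by (simp add: mult.assoc mean_cmult[OF cmult(1)])
  next
    case (unif f)
    have f: "f \<in> ap \<Lambda>"
      by (rule ap.unif) (use unif in blast)
    obtain B where B: "B > 0" "\<And>x. norm (g x) \<le> B"
      using ap_bounded[OF g] by blast
    have Mg: "norm (mean g) \<le> B"
      using mean_dist_le[OF g ap_const[of UNIV 0], of B] B by (simp add: mean_const)
    have "norm (mean (\<lambda>x. f x * g x) - mean f * mean g) \<le> e" if "e > 0" for e
    proof -
      obtain h where h: "h \<in> ap \<Lambda>" "\<And>x. norm (f x - h x) \<le> e/2/B"
        and eq: "mean (\<lambda>x. h x * g x) = mean h * mean g"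
        using unif[of "e/2/B"] \<open>e > 0\<close> B by auto
      have bd: "norm (a * b) \<le> e / 2" if "norm a \<le> e/2/B" "norm b \<le> B" for a b :: complex
        using mult_mono[OF that] \<open>e > 0\<close> B by (simp add: norm_mult)
      have "norm (mean (\<lambda>x. f x * g x) - mean (\<lambda>x. h x * g x)) \<le> e/2"
        using mult[OF f g] mult[OF h(1) g]
        by (rule mean_dist_le) (simp only: left_diff_distrib[symmetric] bd h B)
      moreover have "norm (mean h * mean g - mean f * mean g) \<le> e / 2"
        using mean_dist_le[OF f h(1) h(2)]
        by (simp only: left_diff_distrib[symmetric] bd Mg norm_minus_commute[of "mean h"])
      ultimately show ?thesis
        unfolding eq by (rule norm_diff_le_halves)
    qed
    then show ?case
      using field_le_epsilon[of "norm (mean (\<lambda>x. f x * g x) - mean f * mean g)" 0]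
      by auto
  qed
qed

text \<open>The exponential must not leave the frequency group: a phase factor built from one energy
  then keeps its frequencies among the integer multiples of that energy, which is what independence
  needs.\<close>

lemma ap_iexp:
  assumes \<Lambda>: "0 \<in> \<Lambda>" "\<And>u. u \<in> \<Lambda> \<Longrightarrow> - u \<in> \<Lambda>" "\<And>u v. u \<in> \<Lambda> \<Longrightarrow> v \<in> \<Lambda> \<Longrightarrow> u + v \<in> \<Lambda>"
    and h: "(\<lambda>x. complex_of_real (h x)) \<in> ap \<Lambda>"
  shows "(\<lambda>x. iexp (h x)) \<in> ap \<Lambda>"
proof -
  obtain B where B: "\<And>x. \<bar>h x\<bar> \<le> B"
    using ap_bounded[OF h] by (auto simp: norm_of_real)
  have K: "range (\<lambda>x. complex_of_real (h x)) \<subseteq> cball 0 B"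
    using B by auto
  have cont: "continuous_on (cball 0 B) (\<lambda>z. cos (Re z))" "continuous_on (cball 0 B) (\<lambda>z. sin (Re z))"
    by (intro continuous_intros)+
  have "(\<lambda>x. complex_of_real (cos (Re (complex_of_real (h x))))) \<in> ap \<Lambda>"
       "(\<lambda>x. complex_of_real (sin (Re (complex_of_real (h x))))) \<in> ap \<Lambda>"
    using ap_compose[OF \<Lambda> h compact_cball K cont(1)] ap_compose[OF \<Lambda> h compact_cball K cont(2)]
    by blast+
  then have "(\<lambda>x. complex_of_real (cos (h x)) + \<i> * complex_of_real (sin (h x))) \<in> ap \<Lambda>"
    by (intro ap.add ap.cmult) auto
  moreover have "complex_of_real (cos (h x)) + \<i> * complex_of_real (sin (h x)) = iexp (h x)" for x
    by (simp add: cis_conv_exp[symmetric] complex_eq_iff)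
  ultimately show ?thesis
    by simp
qed

subsection \<open>Sums of independent phases\<close>

lemma of_real_Re_power:
  "complex_of_real (Re z ^ k) = (\<Sum>m\<le>k. of_nat (k choose m) * z ^ m * cnj z ^ (k - m) / 2 ^ k)"
proof -
  have "complex_of_real (Re z ^ k) = ((z + cnj z) / 2) ^ k"
    by (simp add: complex_add_cnj)
  then show ?thesis
    by (simp add: binomial_ring power_divide sum_divide_distrib)
qed

text \<open>In the binomial expansion of Re as half of z + cnj z, the term with index
  \<open>m\<close> has frequency e (k - 2 m). Since \<open>e\<close> is nonzero, only the middle
  term of an even power survives.\<close>

lemma mean_Re_wave_power:
  assumes "e \<noteq> 0"
  shows "mean (\<lambda>t. complex_of_real (Re (v * iexp (- e * t)) ^ k)) =
    (if even k then of_nat (k choose (k div 2)) * of_real (norm v / 2) ^ k else 0)"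
proof -
  define c where "c m = of_nat (k choose m) * (v ^ m * cnj v ^ (k - m)) / 2 ^ k" for m
  have wave: "(\<lambda>t. iexp ((e * (real k - 2 * real m)) * t)) \<in> ap UNIV" for m
    using ap.wave[of "e * (real k - 2 * real m)" UNIV] by simp
  have "complex_of_real (Re (v * iexp (- e * t)) ^ k) =
      (\<Sum>m\<le>k. c m * iexp ((e * (real k - 2 * real m)) * t))" for t
    unfolding of_real_Re_power
  proof (rule sum.cong[OF refl])
    fix m assume "m \<in> {..k}"
    then have k: "real k - 2 * real m = real (k - m) - real m"
      by (simp add: of_nat_diff)
    have "iexp (- e * t) ^ m * cnj (iexp (- e * t)) ^ (k - m) =
        exp (of_nat m * (\<i> * of_real (- e * t))) * exp (of_nat (k - m) * (\<i> * of_real (e * t)))"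
      by (simp only: exp_of_nat_mult exp_cnj) simp
    also have "\<dots> = iexp ((e * (real k - 2 * real m)) * t)"
      unfolding exp_add[symmetric] k by (simp add: algebra_simps)
    finally have wave_power: "iexp (- e * t) ^ m * cnj (iexp (- e * t)) ^ (k - m) =
        iexp ((e * (real k - 2 * real m)) * t)" .
    have "of_nat (k choose m) * (v * w) ^ m * cnj (v * w) ^ (k - m) / 2 ^ k =
        c m * (w ^ m * cnj w ^ (k - m))" for w
      by (simp add: c_def power_mult_distrib)
    then show "of_nat (k choose m) * (v * iexp (- e * t)) ^ m * cnj (v * iexp (- e * t)) ^ (k - m) / 2 ^ k =
        c m * iexp ((e * (real k - 2 * real m)) * t)"
      by (simp only: wave_power)
  qed
  then have "mean (\<lambda>t. complex_of_real (Re (v * iexp (- e * t)) ^ k)) =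
      (\<Sum>m\<le>k. c m * mean (\<lambda>t. iexp ((e * (real k - 2 * real m)) * t)))"
    by (simp only:) (subst mean_sum, (intro ap.cmult wave), simp only: mean_cmult[OF wave])
  also have "\<dots> = (\<Sum>m\<le>k. if k = 2 * m then c m else 0)"
    unfolding mean_wave using assms by (intro sum.cong) auto
  also have "\<dots> = (if even k then of_nat (k choose (k div 2)) * of_real (norm v / 2) ^ k else 0)"
  proof (cases "even k")
    case True
    then obtain l where l: "k = 2 * l"
      by blast
    have "v ^ l * cnj v ^ l = of_real (norm v) ^ k"
      by (simp add: power_mult_distrib[symmetric] complex_norm_square[symmetric] l power_mult)
    then show ?thesis
      by (simp add: l c_def power_divide)
  next
    case False
    then show ?thesis
      by (auto intro!: sum.neutral)
  qed
  finally show ?thesis .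
qed

text \<open>The mean is the Bessel function $J_0(|v|)$, and the polynomial is its Taylor polynomial of degree 4.\<close>

lemma mean_iexp_Re_wave:
  fixes e :: real and v :: complex
  assumes "e \<noteq> 0"
  defines "s \<equiv> (norm v)\<^sup>2 / 4"
  shows "norm (mean (\<lambda>t. iexp (Re (v * iexp (- e * t)))) - of_real (1 - s + s\<^sup>2 / 4)) \<le> s ^ 3 / 36"
proof -
  define x where "x t = Re (v * iexp (- e * t))" for t
  have "(\<lambda>t. v * iexp ((- e) \<bullet> t)) \<in> ap UNIV"
    by (intro ap.cmult ap.wave) auto
  then have x: "(\<lambda>t. complex_of_real (x t)) \<in> ap UNIV"
    unfolding x_def by (intro ap_Re_Im) auto
  then have x_pow: "(\<lambda>t. complex_of_real (x t ^ k)) \<in> ap UNIV" for k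
    by (simp add: ap_power)
  have F: "(\<lambda>t. iexp (x t)) \<in> ap UNIV"
    by (intro ap_iexp x) auto
  \<comment> \<open>Degree 5 rather than 4: the odd moments vanish, so the mean is unchanged, while
    the remainder becomes x^6/720. An even power needs no absolute value, and its mean is 20/720
    times (|v|/2)^6, that is s^3/36.\<close>
  define P where "P t = (\<Sum>k\<le>5. \<i> ^ k / fact k * complex_of_real (x t ^ k))" for t
  have P: "P \<in> ap UNIV"
    unfolding P_def by (intro ap_sum ap.cmult x_pow) auto
  have mean_x: "mean (\<lambda>t. complex_of_real (x t ^ k)) =
      (if even k then of_nat (k choose (k div 2)) * of_real (norm v / 2) ^ k else 0)" for k
    unfolding x_def by (rule mean_Re_wave_power[OF assms(1)])
  have sum_5: "(\<Sum>k\<le>5. h k) = h 0 + h 1 + h 2 + h 3 + h 4 + h 5" for h :: "nat \<Rightarrow> complex"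
    by (simp add: numeral_eq_Suc)
  have choose: "(2::nat) choose 1 = 2" "(4::nat) choose 2 = 6" "(6::nat) choose 3 = 20"
    by (simp_all add: numeral_eq_Suc)
  have "mean P = (\<Sum>k\<le>5. \<i> ^ k / fact k * mean (\<lambda>t. complex_of_real (x t ^ k)))"
    unfolding P_def by (subst mean_sum, (intro ap.cmult x_pow), simp only: mean_cmult[OF x_pow])
  also have "\<dots> = of_real (1 - s + s\<^sup>2 / 4)"
    unfolding mean_x sum_5 using choose
    by (simp add: s_def power_divide fact_numeral field_simps)
  finally have mP: "mean P = of_real (1 - s + s\<^sup>2 / 4)" .
  have "norm (mean (\<lambda>t. iexp (x t) - P t)) \<le> Re (mean (\<lambda>t. complex_of_real (x t ^ 6 / 720)))"
  proof (rule mean_norm_le)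
    show "(\<lambda>t. iexp (x t) - P t) \<in> ap UNIV"
      using ap.add[OF F ap.cmult[OF P, of "-1"]] by simp
    show "(\<lambda>t. complex_of_real (x t ^ 6 / 720)) \<in> ap UNIV"
      using ap.cmult[OF x_pow, of "1/720" 6] by simp
    fix t
    show "norm (iexp (x t) - P t) \<le> x t ^ 6 / 720"
      using iexp_approx1[of "x t" 5]
      by (simp add: P_def power_mult_distrib fact_numeral)
  qed
  also have "mean (\<lambda>t. complex_of_real (x t ^ 6 / 720)) = 1/720 * mean (\<lambda>t. complex_of_real (x t ^ 6))"
    using mean_cmult[OF x_pow, of "1/720" 6] by simp
  also have "\<dots> = of_real (s ^ 3 / 36)"
    unfolding mean_x using choose
    by (simp add: s_def power_divide power_mult[symmetric])
  finally have "norm (mean (\<lambda>t. iexp (x t)) - mean P) \<le> s ^ 3 / 36"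
    by (simp only: mean_diff[OF F P] Re_complex_of_real)
  then show ?thesis
    unfolding mP by (simp only: x_def)
qed

section \<open>Integer combinations of energies and independence of phases\<close>

definition int_span :: "('i \<Rightarrow> real) \<Rightarrow> 'i set \<Rightarrow> real set" where
  "int_span E I = range (\<lambda>c :: 'i \<Rightarrow> int. \<Sum>j\<in>I. of_int (c j) * E j)"

text \<open>Clearing denominators makes this equivalent to independence over the rationals; integer
  coefficients are the ones that arise when waves are multiplied. Coefficients sit on indices, so
  equal energies at distinct indices are excluded.\<close>

definition int_indep :: "('i \<Rightarrow> real) \<Rightarrow> 'i set \<Rightarrow> bool" where
  "int_indep E I \<longleftrightarrow> (\<forall>c :: 'i \<Rightarrow> int. (\<Sum>j\<in>I. of_int (c j) * E j) = 0 \<longrightarrow> (\<forall>j\<in>I. c j = 0))"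

lemma int_span_zero: "0 \<in> int_span E I"
  unfolding int_span_def by (intro range_eqI[of _ _ "\<lambda>_. 0"]) simp

lemma int_span_minus: "u \<in> int_span E I \<Longrightarrow> - u \<in> int_span E I"
proof -
  assume "u \<in> int_span E I"
  then obtain c where "u = (\<Sum>j\<in>I. of_int (c j) * E j)"
    by (auto simp: int_span_def)
  then show ?thesis
    unfolding int_span_def by (intro range_eqI[of _ _ "\<lambda>j. - c j"]) (simp add: sum_negf)
qed

lemma int_span_add: "u \<in> int_span E I \<Longrightarrow> v \<in> int_span E I \<Longrightarrow> u + v \<in> int_span E I"
proof -
  assume "u \<in> int_span E I" "v \<in> int_span E I"
  then obtain b c where "u = (\<Sum>j\<in>I. of_int (b j) * E j)" "v = (\<Sum>j\<in>I. of_int (c j) * E j)"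
    by (auto simp: int_span_def)
  then show ?thesis
    unfolding int_span_def
    by (intro range_eqI[of _ _ "\<lambda>j. b j + c j"]) (simp add: sum.distrib distrib_right)
qed

lemma int_span_mono:
  assumes "finite I" "J \<subseteq> I"
  shows "int_span E J \<subseteq> int_span E I"
proof
  fix u assume "u \<in> int_span E J"
  then obtain c :: "'a \<Rightarrow> int" where c: "u = (\<Sum>j\<in>J. of_int (c j) * E j)"
    by (auto simp: int_span_def)
  have "u = (\<Sum>j\<in>I. of_int (if j \<in> J then c j else 0) * E j)"
    unfolding c using assms by (intro sum.mono_neutral_cong_left) auto
  then show "u \<in> int_span E I"
    unfolding int_span_def by (rule range_eqI[of _ _ "\<lambda>j. if j \<in> J then c j else 0"])
qed

text \<open>Since \<open>i\<close> lies outside \<open>J\<close>, the two combinations merge into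
  one integer relation over \<open>I\<close>, all of whose coefficients vanish. This is the
  frequency condition needed to split off a factor.\<close>

lemma int_indep_disjoint:
  assumes "int_indep E I" "finite I" "insert i J \<subseteq> I" "i \<notin> J"
    and u: "u \<in> int_span E {i}" and v: "v \<in> int_span E J" and "u + v = 0"
  shows "u = 0 \<and> v = 0"
proof -
  obtain m where m: "u = of_int m * E i"
    using u by (auto simp: int_span_def)
  obtain c :: "'a \<Rightarrow> int" where c: "v = (\<Sum>j\<in>J. of_int (c j) * E j)"
    using v by (auto simp: int_span_def)
  define b where "b j = (if j = i then m else if j \<in> J then c j else 0)" for j
  have "(\<Sum>j\<in>I. of_int (b j) * E j) = (\<Sum>j\<in>insert i J. of_int (b j) * E j)"
    using assms by (intro sum.mono_neutral_right) (auto simp: b_def)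
  also have "\<dots> = u + (\<Sum>j\<in>J. of_int (b j) * E j)"
    using assms finite_subset[of "insert i J" I] by (simp add: m b_def)
  also have "(\<Sum>j\<in>J. of_int (b j) * E j) = v"
    unfolding c b_def using assms by (intro sum.cong) auto
  finally have "\<forall>j\<in>I. b j = 0"
    using assms unfolding int_indep_def by simp
  then have "b i = 0"
    using assms by blast
  then have "u = 0"
    by (simp add: b_def m)
  then show ?thesis
    using \<open>u + v = 0\<close> by simp
qed

text \<open>The induction must also carry that the partial product over \<open>J\<close> has its
  frequencies in \<open>int_span E J\<close>; only then is the next factor independent of the whole
  product and not merely of each factor.\<close>

lemma mean_prod_independent:
  assumes "int_indep E I" "finite I" and F: "\<And>j. j \<in> I \<Longrightarrow> F j \<in> ap (int_span E {j})"
  shows "mean (\<lambda>t. \<Prod>j\<in>I. F j t) = (\<Prod>j\<in>I. mean (F j))"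
proof -
  have "finite J \<Longrightarrow> J \<subseteq> I \<Longrightarrow> (\<lambda>t. \<Prod>j\<in>J. F j t) \<in> ap (int_span E J) \<and>
      mean (\<lambda>t. \<Prod>j\<in>J. F j t) = (\<Prod>j\<in>J. mean (F j))" for J
  proof (induction J rule: finite_induct)
    case empty
    then show ?case
      by (simp add: mean_const ap_const int_span_zero)
  next
    case (insert i J)
    then have Fi: "F i \<in> ap (int_span E {i})" and FJ: "(\<lambda>t. \<Prod>j\<in>J. F j t) \<in> ap (int_span E J)"
      using F by auto
    have "F i \<in> ap (int_span E (insert i J))" "(\<lambda>t. \<Prod>j\<in>J. F j t) \<in> ap (int_span E (insert i J))"
      by (rule ap_mono[OF Fi int_span_mono] ap_mono[OF FJ int_span_mono]; use insert in auto)+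
    then have "(\<lambda>t. F i t * (\<Prod>j\<in>J. F j t)) \<in> ap (int_span E (insert i J))"
      by (rule ap_mult) (rule int_span_add)
    moreover have "mean (\<lambda>t. F i t * (\<Prod>j\<in>J. F j t)) = mean (F i) * mean (\<lambda>t. \<Prod>j\<in>J. F j t)"
      using int_indep_disjoint[OF assms(1,2)] insert
      by (intro mean_mult_independent[OF Fi FJ]) auto
    ultimately show ?case
      using insert by simp
  qed
  then show ?thesis
    using assms by blast
qed

definition wave_sum :: "'i set \<Rightarrow> ('i \<Rightarrow> real) \<Rightarrow> ('i \<Rightarrow> real) \<Rightarrow> real \<Rightarrow> complex" where
  "wave_sum I a E t = (\<Sum>j\<in>I. complex_of_real (a j) * iexp (- E j * t))"

lemma wave_sum_ap: "wave_sum I a E \<in> ap UNIV"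
proof -
  have "(\<lambda>t. \<Sum>j\<in>I. complex_of_real (a j) * iexp ((- E j) \<bullet> t)) \<in> ap UNIV"
    by (intro ap_sum ap.cmult ap.wave) auto
  then show ?thesis
    by (simp add: wave_sum_def[abs_def])
qed

lemma int_indep_nonzero: "int_indep E I \<Longrightarrow> finite I \<Longrightarrow> j \<in> I \<Longrightarrow> E j \<noteq> 0"
  unfolding int_indep_def
  by (auto dest!: spec[of _ "\<lambda>i. if i = j then 1 else 0"] simp: if_distrib[of of_int] if_distrib[of "\<lambda>x. x * _"] cong: if_cong)

lemma int_indep_inj:
  assumes "int_indep E I" "finite I"
  shows "inj_on E I"
proof (rule inj_onI, rule ccontr)
  fix i j assume "i \<in> I" "j \<in> I" "E i = E j" "i \<noteq> j"
  have "- E i \<in> int_span E {i}" "E j \<in> int_span E {j}"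
    unfolding int_span_def by (auto intro: range_eqI[of _ _ "\<lambda>_. -1"] range_eqI[of _ _ "\<lambda>_. 1"])
  then have "E j = 0"
    using int_indep_disjoint[OF assms, of i "{j}"] \<open>i \<in> I\<close> \<open>j \<in> I\<close> \<open>E i = E j\<close> \<open>i \<noteq> j\<close> by auto
  then show False
    using int_indep_nonzero[OF assms \<open>j \<in> I\<close>] by simp
qed

text \<open>The inner product with \<open>u\<close> is a sum of real parts of single phases, so its
  exponential is a product of factors, each with frequencies in the multiples of one energy.\<close>

lemma mean_iexp_wave_sum:
  assumes "int_indep E I" "finite I"
  shows "mean (\<lambda>t. iexp (u \<bullet> wave_sum I a E t)) =
    (\<Prod>j\<in>I. mean (\<lambda>t. iexp (Re ((a j * cnj u) * iexp (- E j * t)))))"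
proof -
  have inner: "u \<bullet> wave_sum I a E t = (\<Sum>j\<in>I. Re ((a j * cnj u) * iexp (- E j * t)))" for t
    unfolding wave_sum_def inner_sum_right
    by (intro sum.cong) (auto simp: inner_complex_def algebra_simps)
  have "(\<lambda>t. iexp (Re ((a j * cnj u) * iexp (- E j * t)))) \<in> ap (int_span E {j})" for j
  proof -
    have "- E j \<in> int_span E {j}"
      unfolding int_span_def by (auto intro: range_eqI[of _ _ "\<lambda>_. -1"])
    then have "(\<lambda>t. (a j * cnj u) * iexp ((- E j) \<bullet> t)) \<in> ap (int_span E {j})"
      by (intro ap.cmult ap.wave)
    then show ?thesis
      by (intro ap_iexp ap_Re_Im int_span_zero int_span_add int_span_minus) auto
  qed
  then show ?thesis
    unfolding inner of_real_sum sum_distrib_left exp_sum[OF assms(2)]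
    by (intro mean_prod_independent[OF assms])
qed

text \<open>Parseval: distinct energies make every off-diagonal term oscillate. It supplies the
  second moment that gives tightness.\<close>

lemma mean_norm_wave_sum:
  assumes "int_indep E I" "finite I"
  shows "mean (\<lambda>t. of_real ((norm (wave_sum I a E t))\<^sup>2)) = of_real (\<Sum>j\<in>I. (a j)\<^sup>2)"
proof -
  have wave: "(\<lambda>t. iexp ((E k - E j) * t)) \<in> ap UNIV" for j k
    using ap.wave[of "E k - E j" UNIV] by simp
  have "complex_of_real ((norm (wave_sum I a E t))\<^sup>2) =
      (\<Sum>j\<in>I. \<Sum>k\<in>I. complex_of_real (a j * a k) * iexp ((E k - E j) * t))" for t
  proof -
    have "iexp (- E j * t) * cnj (iexp (- E k * t)) = iexp ((E k - E j) * t)" for j k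
      by (simp add: exp_cnj exp_add[symmetric] algebra_simps)
    then show ?thesis
      unfolding complex_norm_square wave_sum_def cnj_sum sum_product
      by (intro sum.cong refl) (simp only: complex_cnj_mult complex_cnj_complex_of_real of_real_mult mult_ac)
  qed
  then have "mean (\<lambda>t. of_real ((norm (wave_sum I a E t))\<^sup>2)) =
      (\<Sum>j\<in>I. \<Sum>k\<in>I. complex_of_real (a j * a k) * mean (\<lambda>t. iexp ((E k - E j) * t)))"
    by (simp only: mean_sum mean_cmult[OF wave] ap_sum ap.cmult wave UNIV_I)
  also have "\<dots> = (\<Sum>j\<in>I. \<Sum>k\<in>I. if k = j then complex_of_real (a j * a k) else 0)"
    unfolding mean_wave using int_indep_inj[OF assms] by (intro sum.cong) (auto simp: inj_on_def)
  also have "\<dots> = of_real (\<Sum>j\<in>I. (a j)\<^sup>2)"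
    using assms by (simp add: power2_eq_square)
  finally show ?thesis .
qed

section \<open>Taylor bounds for the comparison of factors\<close>

lemma exp_minus_le: 
  fixes s :: real assumes "s \<ge> 0" shows "exp (- s) \<le> 1 - s + s\<^sup>2 / 2"
proof -
  have "1 - 0 + 0\<^sup>2 / 2 - exp (- 0) \<le> 1 - s + s\<^sup>2 / 2 - exp (- s)"
  proof (rule DERIV_nonneg_imp_nondecreasing[OF assms])
    fix x :: real
    show "\<exists>y. DERIV (\<lambda>s. 1 - s + s\<^sup>2 / 2 - exp (- s)) x :> y \<and> 0 \<le> y"
      using exp_ge_add_one_self[of "-x"]
      by (intro exI[of _ "- 1 + x + exp (- x)"]) (auto intro!: derivative_eq_intros)
  qed
  then show ?thesis by simp
qed

text \<open>The derivative of the difference is nonnegative by the preceding bound, as usual for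
  alternating Taylor polynomials.\<close>

lemma exp_minus_ge: 
  fixes s :: real assumes "s \<ge> 0" shows "1 - s + s\<^sup>2 / 2 - s ^ 3 / 6 \<le> exp (- s)"
proof -
  have "exp (- 0) - (1 - 0 + 0\<^sup>2 / 2 - 0 ^ 3 / 6) \<le> exp (- s) - (1 - s + s\<^sup>2 / 2 - s ^ 3 / 6)"
  proof (rule DERIV_nonneg_imp_nondecreasing[OF assms])
    fix x :: real assume "0 \<le> x"
    then show "\<exists>y. DERIV (\<lambda>s. exp (- s) - (1 - s + s\<^sup>2 / 2 - s ^ 3 / 6)) x :> y \<and> 0 \<le> y"
      using exp_minus_le[of x]
      by (intro exI[of _ "- exp (- x) + 1 - x + x\<^sup>2 / 2"]) (auto intro!: derivative_eq_intros)
  qed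
  then show ?thesis by simp
qed

text \<open>The logarithm of 1 - s + s^2/4 is -s - s^2/4 up to cubic terms, so half of the quadratic
  deficit, s^2/8, can be kept while the other half absorbs the higher terms and the Bessel remainder
  s^3/36. The range of \<open>s\<close> is the one that arises at \<open>u = 1\<close>.\<close>

lemma gauss_factor_bound:
  fixes s :: real assumes "0 \<le> s" "s \<le> 1/4"
  shows "1 - s + s\<^sup>2 / 4 + s ^ 3 / 36 \<le> exp (- s - s\<^sup>2 / 8)"
proof -
  have "1 - s + s\<^sup>2 / 4 + s ^ 3 / 36 \<le> (1 - s + s\<^sup>2 / 2 - s ^ 3 / 6) * (1 - s\<^sup>2 / 8)"
  proof -
    have "s\<^sup>2 \<le> (1/4)\<^sup>2" 
      using assms by (intro power_mono) auto
    \<comment> \<open>This is exactly the right side minus the left side, expanded and with s^2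
      factored out.\<close>
    then have "0 \<le> s\<^sup>2 * (1/8 - s * (5/72) - s\<^sup>2 / 16 + s ^ 3 / 48)"
      using assms by (intro mult_nonneg_nonneg) (auto simp: power2_eq_square intro!: add_nonneg_nonneg)
    then show ?thesis
      by (simp add: field_simps power_numeral_reduce)
  qed
  also have "\<dots> \<le> exp (- s) * exp (- (s\<^sup>2 / 8))"
  proof (rule mult_mono)
    show "1 - s\<^sup>2 / 8 \<le> exp (- (s\<^sup>2 / 8))"
      using exp_ge_add_one_self[of "-(s\<^sup>2 / 8)"] by simp
    have "s * s \<le> 1 * 1"
      using assms by (intro mult_mono) auto
    then show "0 \<le> 1 - s\<^sup>2 / 8"
      by (simp add: power2_eq_square)
  qed (use exp_minus_ge assms in auto)
  finally show ?thesis
    by (simp flip: exp_add)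
qed

subsection \<open>The Gaussian characteristic function\<close>

text \<open>Lebesgue measure on a Euclidean space is the image of a product of one-dimensional ones
  under the coordinate map, so Fubini splits products of functions of single coordinates.\<close>

lemma has_bochner_integral_lborel_prod:
  fixes f :: "'a::euclidean_space \<Rightarrow> real \<Rightarrow> complex"
  assumes "\<And>b. b \<in> Basis \<Longrightarrow> integrable lborel (f b)"
  shows "has_bochner_integral lborel (\<lambda>x::'a. \<Prod>b\<in>Basis. f b (x \<bullet> b)) (\<Prod>b\<in>Basis. integral\<^sup>L lborel (f b))"
proof -
  interpret product_sigma_finite "\<lambda>_::'a. lborel :: real measure"
    by standard
  have [measurable]: "f b \<in> borel_measurable borel" if "b \<in> Basis" for b
    using borel_measurable_integrable[OF assms[OF that]] by simp
  have T[measurable]: "(\<lambda>c. \<Sum>b\<in>Basis. c b *\<^sub>R b) \<in> (\<Pi>\<^sub>M b\<in>(Basis :: 'a set). lborel :: real measure) \<rightarrow>\<^sub>M borel"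
    by measurable
  have F[measurable]: "(\<lambda>x::'a. \<Prod>b\<in>Basis. f b (x \<bullet> b)) \<in> borel_measurable borel"
    by measurable
  have eq: "(\<Prod>b\<in>Basis. f b ((\<Sum>i\<in>Basis. c i *\<^sub>R i) \<bullet> b)) = (\<Prod>b\<in>Basis. f b (c b))" for c
    by (intro prod.cong) simp_all
  show ?thesis
    by (subst lborel_eq)
       (simp only: has_bochner_integral_iff integrable_distr_eq[OF T F] integral_distr[OF T F] eq
          product_integrable_prod[OF finite_Basis assms] product_integral_prod[OF finite_Basis assms] simp_thms)
qed

lemma integrable_exp_minus_square: "integrable lborel (\<lambda>x::real. exp (- x\<^sup>2))"
proof -
  have "(\<lambda>x. sqrt pi * normal_density 0 (sqrt (1/2)) x) = (\<lambda>x. exp (- x\<^sup>2))"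
    by (simp add: normal_density_def)
  moreover have "integrable lborel (\<lambda>x. sqrt pi * normal_density 0 (sqrt (1/2)) x)"
    by (intro integrable_mult_right integrable_normal_density) simp
  ultimately show ?thesis
    by (simp only:)
qed

lemma integrable_iexp_exp_minus_square: "integrable lborel (\<lambda>x::real. complex_of_real (exp (- x\<^sup>2)) * iexp (t * x))"
  by (rule Bochner_Integration.integrable_bound[OF integrable_exp_minus_square])
     (auto simp: norm_mult)

lemma integral_iexp_exp_minus_square:
  "(CLBINT x. complex_of_real (exp (- x\<^sup>2)) * iexp (t * x)) = sqrt pi * exp (- t\<^sup>2 / 4)"
proof -
  \<comment> \<open>The weight exp(-x^2) belongs to variance 1/2. Stretching by sqrt 2 reduces it to
    the standard normal law, at the frequency t / sqrt 2.\<close>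
  define s where "s = t / sqrt 2"
  have "complex_of_real (exp (- s\<^sup>2 / 2)) = (CLBINT x. std_normal_density x *\<^sub>R iexp (s * x))"
    using fun_cong[OF char_std_normal_distribution, of s]
    by (simp add: char_def integral_density)
  also have "\<dots> = sqrt 2 *\<^sub>R (CLBINT x. std_normal_density (0 + sqrt 2 * x) *\<^sub>R iexp (s * (0 + sqrt 2 * x)))"
    by (subst lborel_integral_real_affine[of "sqrt 2" _ 0]) simp_all
  also have "(\<lambda>x. std_normal_density (0 + sqrt 2 * x) *\<^sub>R iexp (s * (0 + sqrt 2 * x))) =
      (\<lambda>x. complex_of_real (1 / sqrt (2 * pi)) * (complex_of_real (exp (- x\<^sup>2)) * iexp (t * x)))"
    by (auto simp: s_def std_normal_density_def power_mult_distrib scaleR_conv_of_real)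
  also have "sqrt 2 *\<^sub>R (CLBINT x. complex_of_real (1 / sqrt (2 * pi)) * (complex_of_real (exp (- x\<^sup>2)) * iexp (t * x)))
      = complex_of_real (sqrt 2 / sqrt (2 * pi)) * (CLBINT x. complex_of_real (exp (- x\<^sup>2)) * iexp (t * x))"
    by (simp add: scaleR_conv_of_real)
  also have "sqrt 2 / sqrt (2 * pi) = 1 / sqrt pi"
    by (simp add: real_sqrt_mult)
  finally have "complex_of_real (exp (- s\<^sup>2 / 2)) = complex_of_real (1 / sqrt pi) * (CLBINT x. complex_of_real (exp (- x\<^sup>2)) * iexp (t * x))" .
  moreover have "s\<^sup>2 / 2 = t\<^sup>2 / 4"
    by (simp add: s_def power_divide)
  ultimately show ?thesis
    by (simp add: field_simps)
qed

lemma has_bochner_integral_iexp_gauss2: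
  "has_bochner_integral lborel (\<lambda>y. (exp (- (cmod y)\<^sup>2) / pi) *\<^sub>R iexp (u \<bullet> y)) (exp (- (cmod u)\<^sup>2 / 4))"
proof -
  have prod_Basis: "(\<Prod>b\<in>Basis. g b) = g 1 * g \<i>" for g :: "complex \<Rightarrow> complex"
    by (simp add: Basis_complex_def)
  have int: "has_bochner_integral lborel
      (\<lambda>y. \<Prod>b\<in>Basis. complex_of_real (exp (- (y \<bullet> b)\<^sup>2)) * iexp ((u \<bullet> b) * (y \<bullet> b)))
      (\<Prod>b\<in>Basis. complex_of_real (sqrt pi * exp (- (u \<bullet> b)\<^sup>2 / 4)))"
    using has_bochner_integral_lborel_prod[OF integrable_iexp_exp_minus_square, of "\<lambda>b. u \<bullet> b"]
    unfolding integral_iexp_exp_minus_square .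
  have fun_eq: "(\<Prod>b\<in>Basis. complex_of_real (exp (- (y \<bullet> b)\<^sup>2)) * iexp ((u \<bullet> b) * (y \<bullet> b))) =
      complex_of_real (exp (- (cmod y)\<^sup>2)) * iexp (u \<bullet> y)" for y
  proof -
    have "exp (- (cmod y)\<^sup>2) = exp (- (y \<bullet> 1)\<^sup>2) * exp (- (y \<bullet> \<i>)\<^sup>2)"
      by (simp add: cmod_power2 inner_complex_def exp_add[symmetric])
    moreover have "iexp (u \<bullet> y) = iexp ((u \<bullet> 1) * (y \<bullet> 1)) * iexp ((u \<bullet> \<i>) * (y \<bullet> \<i>))"
      by (simp add: inner_complex_def exp_add[symmetric] distrib_left)
    ultimately show ?thesis
      unfolding prod_Basis by (simp only: of_real_mult mult_ac)
  qed
  have value_eq: "(\<Prod>b\<in>Basis. complex_of_real (sqrt pi * exp (- (u \<bullet> b)\<^sup>2 / 4))) = 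
      complex_of_real (pi * exp (- (cmod u)\<^sup>2 / 4))"
  proof -
    have "(sqrt pi * exp (- (Re u)\<^sup>2 / 4)) * (sqrt pi * exp (- (Im u)\<^sup>2 / 4)) =
        (sqrt pi * sqrt pi) * (exp (- (Re u)\<^sup>2 / 4) * exp (- (Im u)\<^sup>2 / 4))"
      by (simp only: mult_ac)
    also have "exp (- (Re u)\<^sup>2 / 4) * exp (- (Im u)\<^sup>2 / 4) = exp (- (cmod u)\<^sup>2 / 4)"
      by (simp add: exp_add[symmetric] cmod_power2 diff_divide_distrib add_divide_distrib)
    also have "sqrt pi * sqrt pi = pi"
      by simp
    finally have "(sqrt pi * exp (- (Re u)\<^sup>2 / 4)) * (sqrt pi * exp (- (Im u)\<^sup>2 / 4)) = pi * exp (- (cmod u)\<^sup>2 / 4)" .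
    then show ?thesis
      unfolding prod_Basis of_real_mult[symmetric] by (simp add: inner_complex_def)
  qed
  have "has_bochner_integral lborel (\<lambda>y. (1 / pi) *\<^sub>R (complex_of_real (exp (- (cmod y)\<^sup>2)) * iexp (u \<bullet> y)))
      ((1 / pi) *\<^sub>R complex_of_real (pi * exp (- (cmod u)\<^sup>2 / 4)))"
    using int unfolding fun_eq value_eq by (rule has_bochner_integral_scaleR_right)
  moreover have "(1 / pi) *\<^sub>R (complex_of_real x * z) = (x / pi) *\<^sub>R z" for x z
    by (simp add: scaleR_conv_of_real)
  moreover have "(1 / pi) *\<^sub>R complex_of_real (pi * x) = complex_of_real x" for x
    by (simp add: scaleR_conv_of_real)
  ultimately show ?thesis
    by (simp only:)
qed

lemma integral_iexp_std_gauss2: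
  "integral\<^sup>L std_gauss2 (\<lambda>y. iexp (u \<bullet> y)) = exp (- (cmod u)\<^sup>2 / 4)"
  unfolding std_gauss2_def
  by (subst integral_density)
     (use has_bochner_integral_integral_eq[OF has_bochner_integral_iexp_gauss2] in auto)

lemma prob_space_std_gauss2: "prob_space std_gauss2"
proof
  have "has_bochner_integral lborel (\<lambda>y. complex_of_real (exp (- (cmod y)\<^sup>2) / pi)) 1"
    using has_bochner_integral_iexp_gauss2[of 0] by (simp add: scaleR_conv_of_real)
  from has_bochner_integral_Re[OF this] have *: "has_bochner_integral lborel (\<lambda>y. exp (- (cmod y)\<^sup>2) / pi) 1"
    by simp
  show "emeasure std_gauss2 (space std_gauss2) = 1"
    unfolding std_gauss2_def
    using has_bochner_integral_iff[THEN iffD1, OF *]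
    by (simp add: emeasure_density nn_integral_eq_integral)
qed

lemma sets_std_gauss2 [simp]: "sets std_gauss2 = sets borel"
  by (simp add: std_gauss2_def)

lemma ap_compose_complex:
  assumes G: "continuous_on UNIV (G :: complex \<Rightarrow> complex)" and f: "f \<in> ap UNIV"
  shows "(\<lambda>x. G (f x)) \<in> ap UNIV"
proof -
  obtain B where "\<And>x. norm (f x) \<le> B"
    using ap_bounded[OF f] by blast
  then have K: "range f \<subseteq> cball 0 B"
    by auto
  have "(\<lambda>x. complex_of_real (h (G (f x)))) \<in> ap UNIV" if h: "bounded_linear h" for h
  proof (rule ap_compose[OF _ _ _ f compact_cball K])
    show "continuous_on (cball 0 B) (\<lambda>z. h (G z))"
      using continuous_on_subset[OF G] by (intro bounded_linear.continuous_on[OF h]) auto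
  qed auto
  from ap.add[OF this[OF bounded_linear_Re] ap.cmult[OF this[OF bounded_linear_Im], of \<i>]]
  show ?thesis
    by (simp add: complex_eq[symmetric])
qed

subsection \<open>Continuity theorem\<close>

lemma has_time_avg_mean:
  assumes h: "(\<lambda>t. complex_of_real (h t)) \<in> ap \<Lambda>"
  shows "has_time_avg h (Re (mean (\<lambda>t. complex_of_real (h t))))"
proof -
  have "continuous_on UNIV h"
    using continuous_on_Re[OF ap_continuous[OF h]] by simp
  then have int: "h integrable_on {0..T}" for T
    by (auto intro!: integrable_continuous_real intro: continuous_on_subset)
  have "integral {0..T} (\<lambda>t. complex_of_real (h t)) = complex_of_real (integral {0..T} h)" for T
    using has_integral_of_real[OF integrable_integral[OF int]] by (rule integral_unique)
  then have "Re (avg (\<lambda>t. complex_of_real (h t)) T) = integral {0..T} h / T" for T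
    by (simp add: avg_def divide_inverse mult.commute)
  then show ?thesis
    using tendsto_Re[OF avg_tendsto_mean[OF h]] by (simp add: has_time_avg_def)
qed

lemma mean_Re:
  assumes "f \<in> ap \<Lambda>"
  shows "mean (\<lambda>t. complex_of_real (Re (f t))) = of_real (Re (mean f))"
proof -
  have int: "f integrable_on {0..T}" for T
    using ap_continuous[OF assms] by (auto intro!: integrable_continuous_real intro: continuous_on_subset)
  have "((\<lambda>t. complex_of_real (Re (f t))) has_integral of_real (Re (integral {0..T} f))) {0..T}" for T
    using has_integral_of_real[OF has_integral_linear[OF integrable_integral[OF int] bounded_linear_Re]]
    by (simp add: o_def)
  then have int_Re: "integral {0..T} (\<lambda>t. complex_of_real (Re (f t))) = of_real (Re (integral {0..T} f))" for T
    by (rule integral_unique)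
  have avg_Re: "avg (\<lambda>t. complex_of_real (Re (f t))) T = of_real (Re (avg f T))" for T
    unfolding avg_def int_Re scaleR_complex.simps by (simp only: of_real_mult scaleR_conv_of_real)
  then show ?thesis
    using tendsto_of_real[OF tendsto_Re[OF avg_tendsto_mean[OF assms]], where 'a=complex]
    by (intro mean_eqI) (simp only: avg_Re[abs_def])
qed

lemma integrable_ap:
  assumes "prob_space M" "sets M = sets borel" "f \<in> ap \<Lambda>"
  shows "integrable M f"
proof -
  interpret prob_space M by fact
  obtain B where "\<And>x. norm (f x) \<le> B"
    using ap_bounded[OF assms(3)] by blast
  moreover have "f \<in> borel_measurable M"
    using borel_measurable_continuous_onI[OF ap_continuous[OF assms(3)]] measurable_cong_sets[OF assms(2) refl]
    by blast
  ultimately show ?thesis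
    by (intro integrable_const_bound[of _ B]) auto
qed

lemma prob_integral_dist_le:
  fixes f g :: "'a \<Rightarrow> complex"
  assumes "prob_space M" "integrable M f" "integrable M g" "\<And>x. norm (f x - g x) \<le> e"
  shows "norm (integral\<^sup>L M f - integral\<^sup>L M g) \<le> e"
proof -
  interpret prob_space M by fact
  have "norm (integral\<^sup>L M (\<lambda>x. f x - g x)) \<le> e"
    using assms by (intro integral_norm_bound[THEN order_trans] integral_le_const) auto
  then show ?thesis
    using assms by simp
qed

text \<open>The hypothesis \<open>char\<close> is the case of a single wave. The time mean and the
  integral against \<open>M\<close> are both linear and do not increase the supremum norm, so
  convergence passes to uniform limits.\<close>

lemma tendsto_mean_ap:
  fixes Y :: "nat \<Rightarrow> real \<Rightarrow> complex" and M :: "complex measure"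
  assumes M: "prob_space M" "sets M = sets borel"
    and Y: "\<And>n. Y n \<in> ap UNIV"
    and char: "\<And>u. (\<lambda>n. mean (\<lambda>t. iexp (u \<bullet> Y n t))) \<longlonglongrightarrow> integral\<^sup>L M (\<lambda>y. iexp (u \<bullet> y))"
    and f: "f \<in> ap UNIV"
  shows "(\<lambda>n. mean (\<lambda>t. f (Y n t))) \<longlonglongrightarrow> integral\<^sup>L M f"
  using f
proof (induction rule: ap.induct)
  case (wave u)
  show ?case by (rule char)
next
  case (add f g)
  have "(\<lambda>t. f (Y n t)) \<in> ap UNIV" "(\<lambda>t. g (Y n t)) \<in> ap UNIV" for n
    using add Y by (auto intro: ap_compose_complex ap_continuous)
  then show ?case
    using tendsto_add[OF add.IH] integrable_ap[OF M add(1)] integrable_ap[OF M add(2)] by (simp add: mean_add[of _ UNIV _ UNIV])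
next
  case (cmult f c)
  have "(\<lambda>t. f (Y n t)) \<in> ap UNIV" for n
    using cmult Y by (auto intro: ap_compose_complex ap_continuous)
  then show ?case
    using tendsto_mult_left[OF cmult.IH, of c] by (simp add: mean_cmult[of _ UNIV])
next
  case (unif f)
  have f: "f \<in> ap UNIV"
    by (rule ap.unif) (use unif in blast)
  show ?case
  proof (rule tendstoI)
    fix e :: real assume "e > 0"
    then obtain g where g: "g \<in> ap UNIV" "\<And>x. norm (f x - g x) \<le> e/3"
      and lim: "(\<lambda>n. mean (\<lambda>t. g (Y n t))) \<longlonglongrightarrow> integral\<^sup>L M g"
      using unif[of "e/3"] by auto
    have 1: "norm (mean (\<lambda>t. f (Y n t)) - mean (\<lambda>t. g (Y n t))) \<le> e/3" for n
      by (rule mean_dist_le[OF ap_compose_complex[OF ap_continuous[OF f] Y]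
            ap_compose_complex[OF ap_continuous[OF g(1)] Y] g(2)])
    have 2: "norm (integral\<^sup>L M f - integral\<^sup>L M g) \<le> e/3"
      by (rule prob_integral_dist_le[OF M(1) integrable_ap[OF M f] integrable_ap[OF M g(1)] g(2)])
    have "\<forall>\<^sub>F n in sequentially. dist (mean (\<lambda>t. g (Y n t))) (integral\<^sup>L M g) < e/3"
      using lim \<open>e > 0\<close> by (intro tendstoD) auto
    then show "\<forall>\<^sub>F n in sequentially. dist (mean (\<lambda>t. f (Y n t))) (integral\<^sup>L M f) < e"
    proof eventually_elim
      case (elim n)
      then show ?case
        using 1[of n] 2 dist_triangle[of "mean (\<lambda>t. f (Y n t))" "integral\<^sup>L M f" "mean (\<lambda>t. g (Y n t))"]
          dist_triangle[of "mean (\<lambda>t. g (Y n t))" "integral\<^sup>L M f" "integral\<^sup>L M g"]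
        by (simp add: dist_norm norm_minus_commute)
    qed
  qed
qed

text \<open>The identity on the disc of radius \<open>L\<close>, and periodic on the whole plane.\<close>

definition fold_square :: "real \<Rightarrow> complex \<Rightarrow> complex" where
  "fold_square L y = Complex (L * arcsin (sin (Re y / L))) (L * arcsin (sin (Im y / L)))"

lemma fold_square_eq:
  assumes "L > 0" "norm y \<le> L"
  shows "fold_square L y = y"
proof -
  have "\<bar>Re y / L\<bar> \<le> 1" "\<bar>Im y / L\<bar> \<le> 1"
    using assms abs_Re_le_cmod[of y] abs_Im_le_cmod[of y] by auto
  then have "\<bar>Re y / L\<bar> \<le> pi / 2" "\<bar>Im y / L\<bar> \<le> pi / 2"
    using pi_ge_two by linarith+
  then have "arcsin (sin (Re y / L)) = Re y / L" "arcsin (sin (Im y / L)) = Im y / L"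
    by (intro arcsin_sin; linarith)+
  then show ?thesis
    using assms by (simp add: fold_square_def complex_eq_iff)
qed

text \<open>As a function of the two sine waves sin(Re y / L) and sin(Im y / L), the folded test
  function is continuous on the square where both coordinates lie in [-1,1]. That square serves as
  the compact set for \<open>ap_compose\<close>, as arcsin is controlled only there.\<close>

lemma ap_fold_square:
  fixes g :: "complex \<Rightarrow> real"
  assumes g: "continuous_on UNIV g"
  shows "(\<lambda>y. complex_of_real (g (fold_square L y))) \<in> ap UNIV"
proof -
  define f where "f y = complex_of_real (sin (Re y / L)) + \<i> * complex_of_real (sin (Im y / L))" for y
  have w: "(\<lambda>y. iexp (complex_of_real (1/L) \<bullet> y)) \<in> ap UNIV" "(\<lambda>y. iexp ((\<i> * complex_of_real (1/L)) \<bullet> y)) \<in> ap UNIV"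
    by (intro ap.wave UNIV_I)+
  have Im_iexp: "Im (iexp x) = sin x" for x
    by (simp add: cis_conv_exp[symmetric])
  have "complex_of_real (1/L) \<bullet> y = Re y / L" "(\<i> * complex_of_real (1/L)) \<bullet> y = Im y / L" for y
    by (simp_all add: inner_complex_def)
  then have "Im (iexp (complex_of_real (1/L) \<bullet> y)) = sin (Re y / L)"
       "Im (iexp ((\<i> * complex_of_real (1/L)) \<bullet> y)) = sin (Im y / L)" for y
    by (simp_all only: Im_iexp)
  then have f: "f \<in> ap UNIV"
    using ap.add[OF ap_Re_Im(2)[OF w(1)] ap.cmult[OF ap_Re_Im(2)[OF w(2)], of \<i>]]
    by (simp only: f_def[abs_def] UNIV_I)
  define K where "K = cbox (- 1 - \<i>) (1 + \<i>)"
  have K: "compact K" "range f \<subseteq> K"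
    by (auto simp: K_def f_def in_cbox_complex_iff)
  have "continuous_on K (\<lambda>z. g (Complex (L * arcsin (Re z)) (L * arcsin (Im z))))"
  proof (rule continuous_on_compose2[OF g])
    show "continuous_on K (\<lambda>z. Complex (L * arcsin (Re z)) (L * arcsin (Im z)))"
      unfolding Complex_eq
      by (intro continuous_intros) (auto simp: K_def in_cbox_complex_iff)
  qed auto
  from ap_compose[OF _ _ _ f K this] show ?thesis
    by (simp add: f_def fold_square_def)
qed

text \<open>Bounded second moments give tightness; on a large disc the test function agrees with an
  almost periodic one of the same supremum norm.\<close>

lemma conv_dist_time_avgI:
  fixes Y :: "nat \<Rightarrow> real \<Rightarrow> complex" and M :: "complex measure"
  assumes M: "prob_space M" "sets M = sets borel"
    and Y: "\<And>n. Y n \<in> ap UNIV"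
    and moment: "\<And>n. Re (mean (\<lambda>t. of_real ((norm (Y n t))\<^sup>2))) \<le> C"
    and char: "\<And>u. (\<lambda>n. mean (\<lambda>t. iexp (u \<bullet> Y n t))) \<longlonglongrightarrow> integral\<^sup>L M (\<lambda>y. iexp (u \<bullet> y))"
  shows "conv_dist_time_avg Y M"
  unfolding conv_dist_time_avg_def
proof (intro allI impI)
  fix g :: "complex \<Rightarrow> real"
  assume "continuous_on UNIV g \<and> bounded (range g)"
  then obtain B where g: "continuous_on UNIV g" and B: "\<And>y. \<bar>g y\<bar> \<le> B"
    by (auto simp: bounded_iff)
  have "B \<ge> 0"
    using B[of 0] by linarith
  interpret prob_space M by fact
  have g_meas: "g \<in> borel_measurable M"
    using borel_measurable_continuous_onI[OF g] measurable_cong_sets[OF M(2) refl] by blast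
  define G where "G y = complex_of_real (g y)" for y
  have G: "continuous_on UNIV G"
    unfolding G_def by (intro continuous_intros g)
  have GY: "(\<lambda>t. G (Y n t)) \<in> ap UNIV" for n
    by (rule ap_compose_complex[OF G Y])
  define F where "F L y = complex_of_real (g (fold_square L y))" for L y
  have F: "F L \<in> ap UNIV" for L
    unfolding F_def by (rule ap_fold_square[OF g])
  have FY: "(\<lambda>t. F L (Y n t)) \<in> ap UNIV" for L n
    by (rule ap_compose_complex[OF ap_continuous[OF F] Y])
  have sq: "(\<lambda>t. complex_of_real (c * (norm (Y n t))\<^sup>2)) \<in> ap UNIV" for n c
    by (rule ap_compose_complex[OF _ Y]) (intro continuous_intros)
  have sq1: "(\<lambda>t. complex_of_real ((norm (Y n t))\<^sup>2)) \<in> ap UNIV" for n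
    using sq[of 1] by simp
  have F_close: "norm (mean (\<lambda>t. G (Y n t)) - mean (\<lambda>t. F L (Y n t))) \<le> 2 * B * C / L\<^sup>2" if "L > 0" for L n
  proof -
    \<comment> \<open>Chebyshev in functional form: the difference vanishes on the disc, and outside
      it 2 B is enlarged by the factor |y|^2 / L^2, which is at least 1. Unlike the indicator of the
      exterior, this majorant is continuous, so its mean along the signal exists.\<close>
    have pointwise: "norm (G y - F L y) \<le> 2 * B / L\<^sup>2 * (norm y)\<^sup>2" for y
    proof (cases "norm y \<le> L")
      case True
      then show ?thesis
        using that \<open>B \<ge> 0\<close> by (simp add: G_def F_def fold_square_eq)
    next
      case False
      have "norm (G y - F L y) = \<bar>g y - g (fold_square L y)\<bar>"
        by (simp only: G_def F_def of_real_diff[symmetric] norm_of_real)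
      also have "\<dots> \<le> 2 * B"
        using B[of y] B[of "fold_square L y"] by linarith
      also have "\<dots> \<le> 2 * B * ((norm y)\<^sup>2 / L\<^sup>2)"
      proof -
        have "L\<^sup>2 \<le> (norm y)\<^sup>2"
          using False that by (intro power_mono) auto
        then have "1 \<le> (norm y)\<^sup>2 / L\<^sup>2"
          using that by simp
        then show ?thesis
          using \<open>B \<ge> 0\<close> mult_left_mono[of 1 "(norm y)\<^sup>2 / L\<^sup>2" "2 * B"] by simp
      qed
      finally show ?thesis
        by simp
    qed
    have "norm (mean (\<lambda>t. G (Y n t) - F L (Y n t))) \<le> Re (mean (\<lambda>t. complex_of_real (2 * B / L\<^sup>2 * (norm (Y n t))\<^sup>2)))"
    proof (rule mean_norm_le[OF _ sq pointwise])
      show "(\<lambda>t. G (Y n t) - F L (Y n t)) \<in> ap UNIV"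
        using ap.add[OF GY ap.cmult[OF FY, of "-1"]] by simp
    qed
    also have "\<dots> = 2 * B / L\<^sup>2 * Re (mean (\<lambda>t. complex_of_real ((norm (Y n t))\<^sup>2)))"
      using mean_cmult[OF sq1, of "complex_of_real (2 * B / L\<^sup>2)" n] by simp
    also have "\<dots> \<le> 2 * B / L\<^sup>2 * C"
      using moment[of n] \<open>B \<ge> 0\<close> by (intro mult_left_mono) auto
    finally show ?thesis
      by (simp add: mean_diff[OF GY FY])
  qed
  \<comment> \<open>The folding is also removed on the Gaussian side: each point eventually lies in
    the disc where the folding is the identity, and the bound \<open>B\<close> of the test function
    dominates.\<close>
  have int_lim: "(\<lambda>k. integral\<^sup>L M (F (Suc k))) \<longlonglongrightarrow> integral\<^sup>L M G"
  proof (rule integral_dominated_convergence[where w="\<lambda>_. B"])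
    show "G \<in> borel_measurable M"
      unfolding G_def using g_meas by measurable
    show "F (Suc k) \<in> borel_measurable M" for k
      by (rule borel_measurable_integrable[OF integrable_ap[OF M F]])
    show "AE y in M. (\<lambda>k. F (Suc k) y) \<longlonglongrightarrow> G y"
    proof (rule AE_I2)
      fix y :: complex
      obtain N where N: "norm y \<le> real N"
        using real_arch_simple by blast
      have "\<forall>\<^sub>F k in sequentially. F (Suc k) y = G y"
        using eventually_ge_at_top[of N]
      proof eventually_elim
        case (elim k)
        then have "fold_square (Suc k) y = y"
          using N by (intro fold_square_eq) auto
        then show ?case
          by (simp only: F_def G_def)
      qed
      then show "(\<lambda>k. F (Suc k) y) \<longlonglongrightarrow> G y"
        by (rule tendsto_eventually)
    qed
    show "AE y in M. norm (F (Suc k) y) \<le> B" for k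
      using B by (simp add: F_def)
  qed simp
  have lim: "(\<lambda>n. mean (\<lambda>t. G (Y n t))) \<longlonglongrightarrow> integral\<^sup>L M G"
  proof (rule tendstoI)
    fix e :: real assume "e > 0"
    have "(\<lambda>k. 2 * B * C / (real (Suc k))\<^sup>2) \<longlonglongrightarrow> 0"
      by real_asymp
    then have "\<forall>\<^sub>F k in sequentially. 2 * B * C / (real (Suc k))\<^sup>2 < e / 3"
      using \<open>e > 0\<close> by (intro order_tendstoD) auto
    moreover have "\<forall>\<^sub>F k in sequentially. dist (integral\<^sup>L M (F (Suc k))) (integral\<^sup>L M G) < e / 3"
      using int_lim \<open>e > 0\<close> by (intro tendstoD) auto
    ultimately have "\<forall>\<^sub>F k in sequentially. 2 * B * C / (real (Suc k))\<^sup>2 < e / 3 \<and>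
        dist (integral\<^sup>L M (F (Suc k))) (integral\<^sup>L M G) < e / 3"
      by eventually_elim simp
    then obtain k where k: "2 * B * C / (real (Suc k))\<^sup>2 < e / 3"
        "dist (integral\<^sup>L M (F (Suc k))) (integral\<^sup>L M G) < e / 3"
      by (auto dest: eventually_happens)
    have "\<forall>\<^sub>F n in sequentially. dist (mean (\<lambda>t. F (Suc k) (Y n t))) (integral\<^sup>L M (F (Suc k))) < e / 3"
      using \<open>e > 0\<close> by (intro tendstoD tendsto_mean_ap[OF M Y char F]) auto
    then show "\<forall>\<^sub>F n in sequentially. dist (mean (\<lambda>t. G (Y n t))) (integral\<^sup>L M G) < e"
    proof eventually_elim
      case (elim n)
      have "dist (mean (\<lambda>t. G (Y n t))) (mean (\<lambda>t. F (Suc k) (Y n t))) < e / 3"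
        using F_close[of "Suc k" n] k(1) by (simp add: dist_norm)
      then show ?case
        using k(2) elim
          dist_triangle[of "mean (\<lambda>t. G (Y n t))" "integral\<^sup>L M G" "mean (\<lambda>t. F (Suc k) (Y n t))"]
          dist_triangle[of "mean (\<lambda>t. F (Suc k) (Y n t))" "integral\<^sup>L M G" "integral\<^sup>L M (F (Suc k))"]
        by linarith
    qed
  qed
  have "Re (integral\<^sup>L M G) = integral\<^sup>L M g"
    by (simp add: G_def[abs_def])
  then have "(\<lambda>n. Re (mean (\<lambda>t. G (Y n t)))) \<longlonglongrightarrow> integral\<^sup>L M g"
    using tendsto_Re[OF lim] by simp
  moreover have "has_time_avg (\<lambda>t. g (Y n t)) (Re (mean (\<lambda>t. G (Y n t))))" for n
    using has_time_avg_mean[OF GY[unfolded G_def]] by (simp add: G_def)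
  ultimately show "\<exists>a. (\<forall>n. has_time_avg (\<lambda>t. g (Y n t)) (a n)) \<and> a \<longlonglongrightarrow> integral\<^sup>L M g"
    by (intro exI[of _ "\<lambda>n. Re (mean (\<lambda>t. G (Y n t)))"]) auto
qed

text \<open>The definition only asserts some time averages; uniqueness of limits identifies them
  with \<open>mean\<close>.\<close>

lemma conv_dist_time_avgD:
  assumes conv: "conv_dist_time_avg Y M" and Y: "\<And>n. Y n \<in> ap UNIV"
    and g: "continuous_on UNIV g" "bounded (range g)"
  shows "(\<lambda>n. Re (mean (\<lambda>t. complex_of_real (g (Y n t))))) \<longlonglongrightarrow> integral\<^sup>L M g"
proof -
  obtain a where a: "\<And>n. has_time_avg (\<lambda>t. g (Y n t)) (a n)" "a \<longlonglongrightarrow> integral\<^sup>L M g"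
    using conv g unfolding conv_dist_time_avg_def by blast
  have "a n = Re (mean (\<lambda>t. complex_of_real (g (Y n t))))" for n
  proof -
    have "continuous_on UNIV (\<lambda>y. complex_of_real (g y))"
      by (intro continuous_intros g)
    then show ?thesis
      using has_time_avg_mean[OF ap_compose_complex[OF _ Y]] a(1)[of n]
      unfolding has_time_avg_def by (intro tendsto_unique[OF trivial_limit_at_top_linorder]) auto
  qed
  then show ?thesis
    using a(2) by presburger
qed

subsection \<open>Comparison with the Gaussian\<close>

lemma norm_mean_iexp_le_1:
  assumes "(\<lambda>t. complex_of_real (h t)) \<in> ap UNIV"
  shows "norm (mean (\<lambda>t. iexp (h t))) \<le> 1"
proof -
  have "(\<lambda>t. iexp (h t)) \<in> ap UNIV"
    by (intro ap_iexp assms) auto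
  from mean_dist_le[OF this ap_const[of UNIV 0], of 1] show ?thesis
    by (simp add: mean_const)
qed

lemma norm_char_wave_sum_diff_le:
  fixes a E :: "'i \<Rightarrow> real" and u :: complex
  assumes E: "int_indep E I" and I: "finite I" and a: "(\<Sum>j\<in>I. (a j)\<^sup>2) = 1"
  defines "r \<equiv> (norm u)\<^sup>2 / 4"
  shows "norm (mean (\<lambda>t. iexp (u \<bullet> wave_sum I a E t)) - exp (- r)) \<le> r\<^sup>2 * (1 + r) * (\<Sum>j\<in>I. a j ^ 4)"
proof -
  define m where "m j = mean (\<lambda>t. iexp (Re ((a j * cnj u) * iexp (- E j * t))))" for j
  define s where "s j = (a j)\<^sup>2 * r" for j
  have "r \<ge> 0"
    by (simp add: r_def)
  then have s0: "s j \<ge> 0" for j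
    by (simp add: s_def)
  have m1: "norm (m j) \<le> 1" for j
  proof -
    have "(\<lambda>t. (a j * cnj u) * iexp ((- E j) \<bullet> t)) \<in> ap UNIV"
      by (intro ap.cmult ap.wave) auto
    then show ?thesis
      unfolding m_def by (intro norm_mean_iexp_le_1 ap_Re_Im) auto
  qed
  have factor: "norm (m j - of_real (exp (- s j))) \<le> r\<^sup>2 * (1 + r) * a j ^ 4" if j: "j \<in> I" for j
  proof -
    have "(norm (a j * cnj u))\<^sup>2 / 4 = s j"
      by (simp add: s_def r_def norm_mult power_mult_distrib)
    then have "norm (m j - of_real (1 - s j + (s j)\<^sup>2 / 4)) \<le> s j ^ 3 / 36"
      unfolding m_def using mean_iexp_Re_wave[OF int_indep_nonzero[OF E I j], of "a j * cnj u"] by simp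
    \<comment> \<open>By 1 - s \<le> exp(-s) \<le> 1 - s + s^2/2, the Taylor value 1 - s + s^2/4 is
      the midpoint of an interval of length s^2/2 that contains exp(-s).\<close>
    moreover have "norm (complex_of_real (1 - s j + (s j)\<^sup>2 / 4) - of_real (exp (- s j))) \<le> (s j)\<^sup>2 / 4"
      using exp_ge_add_one_self[of "- s j"] exp_minus_le[OF s0, of j]
      unfolding of_real_diff[symmetric] norm_of_real by linarith
    ultimately have "norm (m j - of_real (exp (- s j))) \<le> s j ^ 3 / 36 + (s j)\<^sup>2 / 4"
      using norm_diff_triangle_le by blast
    \<comment> \<open>Only the order s_j^2 = r^2 a_j^4 matters, so the constants are generous; the
      normalisation gives s_j \<le> r and makes the remaining factor uniform in
      \<open>j\<close>.\<close>
    also have "\<dots> \<le> (s j)\<^sup>2 * (1 + s j)"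
    proof -
      have "(s j)\<^sup>2 * (1 + s j) = (s j)\<^sup>2 + s j ^ 3"
        by (simp add: algebra_simps power2_eq_square power3_eq_cube)
      then show ?thesis
        using zero_le_power[OF s0, of j 2] zero_le_power[OF s0, of j 3] by linarith
    qed
    also have "\<dots> \<le> (s j)\<^sup>2 * (1 + r)"
    proof -
      have "(a j)\<^sup>2 \<le> 1"
        using member_le_sum[OF j, of "\<lambda>j. (a j)\<^sup>2"] I a by simp
      then have "s j \<le> r"
        using \<open>r \<ge> 0\<close> by (simp add: s_def mult_left_le_one_le)
      then show ?thesis
        by (intro mult_left_mono) auto
    qed
    also have "\<dots> = r\<^sup>2 * (1 + r) * a j ^ 4"
      by (simp add: s_def power_mult_distrib)
    finally show ?thesis .
  qed
  have "exp (- r) = (\<Prod>j\<in>I. exp (- s j))"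
    using I a by (simp add: exp_sum[symmetric] s_def sum_negf flip: sum_distrib_right)
  then have "norm (mean (\<lambda>t. iexp (u \<bullet> wave_sum I a E t)) - exp (- r)) =
      norm ((\<Prod>j\<in>I. m j) - (\<Prod>j\<in>I. complex_of_real (exp (- s j))))"
    unfolding mean_iexp_wave_sum[OF E I] m_def by simp
  \<comment> \<open>Telescoping: when all factors lie in the unit disc, two products differ by at
    most the sum of the differences of their factors.\<close>
  also have "\<dots> \<le> (\<Sum>j\<in>I. norm (m j - of_real (exp (- s j))))"
    using s0 by (intro norm_prod_diff m1) auto
  also have "\<dots> \<le> (\<Sum>j\<in>I. r\<^sup>2 * (1 + r) * a j ^ 4)"
    by (intro sum_mono factor)
  finally show ?thesis
    by (simp add: sum_distrib_left)
qed

text \<open>At \<open>u = 1\<close> each s_j = a_j^2/4 lies in [0, 1/4], so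
  \<open>gauss_factor_bound\<close> applies however large a single weight is. The constant 128 is 8
  times 16, from s_j^2/8.\<close>

lemma norm_char_wave_sum_le:
  fixes a E :: "'i \<Rightarrow> real"
  assumes E: "int_indep E I" and I: "finite I" and a: "(\<Sum>j\<in>I. (a j)\<^sup>2) = 1"
  shows "norm (mean (\<lambda>t. iexp (1 \<bullet> wave_sum I a E t))) \<le> exp (- 1 / 4 - (\<Sum>j\<in>I. a j ^ 4) / 128)"
proof -
  define m where "m j = mean (\<lambda>t. iexp (Re ((a j * cnj 1) * iexp (- E j * t))))" for j
  define s where "s j = (a j)\<^sup>2 / 4" for j
  have factor: "norm (m j) \<le> exp (- s j - (s j)\<^sup>2 / 8)" if j: "j \<in> I" for j
  proof -
    have "(a j)\<^sup>2 \<le> 1"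
      using member_le_sum[OF j, of "\<lambda>j. (a j)\<^sup>2"] I a by simp
    then have s: "0 \<le> s j" "s j \<le> 1/4"
      by (auto simp: s_def)
    have "(norm (a j * cnj 1))\<^sup>2 / 4 = s j"
      by (simp add: s_def)
    then have "norm (m j - of_real (1 - s j + (s j)\<^sup>2 / 4)) \<le> s j ^ 3 / 36"
      unfolding m_def using mean_iexp_Re_wave[OF int_indep_nonzero[OF E I j], of "a j * cnj 1"] by simp
    moreover have "norm (complex_of_real (1 - s j + (s j)\<^sup>2 / 4)) = 1 - s j + (s j)\<^sup>2 / 4"
      unfolding norm_of_real using s by simp
    ultimately have "norm (m j) \<le> 1 - s j + (s j)\<^sup>2 / 4 + s j ^ 3 / 36"
      using norm_triangle_sub[of "m j" "complex_of_real (1 - s j + (s j)\<^sup>2 / 4)"] by linarith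
    then show ?thesis
      using gauss_factor_bound[OF s] by linarith
  qed
  have "norm (mean (\<lambda>t. iexp (1 \<bullet> wave_sum I a E t))) = (\<Prod>j\<in>I. norm (m j))"
    unfolding mean_iexp_wave_sum[OF E I] m_def by (simp add: prod_norm)
  also have "\<dots> \<le> (\<Prod>j\<in>I. exp (- s j - (s j)\<^sup>2 / 8))"
    using factor by (intro prod_mono) auto
  also have "\<dots> = exp (\<Sum>j\<in>I. - s j - (s j)\<^sup>2 / 8)"
    using I by (simp add: exp_sum)
  also have "(\<Sum>j\<in>I. - s j - (s j)\<^sup>2 / 8) = - (\<Sum>j\<in>I. (a j)\<^sup>2) / 4 - (\<Sum>j\<in>I. a j ^ 4) / 128"
    by (simp add: s_def power_divide sum_subtractf sum_negf sum_divide_distrib)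
  finally show ?thesis
    using a by simp
qed

section \<open>Normalised weights and moment ratios\<close>

definition unit_weight :: "(nat \<Rightarrow> real) \<Rightarrow> nat \<Rightarrow> nat \<Rightarrow> real" where
  "unit_weight d n j = d j / sqrt (\<Sum>j=1..n. (d j)\<^sup>2)"

lemma sum_unit_weight_square:
  assumes "\<forall>j\<in>{1..n}. d j > 0" "n > 0"
  shows "(\<Sum>j=1..n. (unit_weight d n j)\<^sup>2) = 1"
proof -
  have "(\<Sum>j=1..n. (d j)\<^sup>2) > 0"
    using assms(2) by (intro sum_pos zero_less_power bspec[OF assms(1)]) auto
  then show ?thesis
    by (simp add: unit_weight_def power_divide sum_divide_distrib[symmetric])
qed

lemma Ysig_eq: "Ysig d E n = wave_sum {1..n} (unit_weight d n) E"
proof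
  fix t
  show "Ysig d E n t = wave_sum {1..n} (unit_weight d n) E t"
    unfolding Ysig_def Zsig_def wave_sum_def unit_weight_def sum_divide_distrib
    by (intro sum.cong) (simp_all add: mult.commute)
qed

text \<open>For positive \<open>n\<close> the squared unit weights form a probability vector, and
  the ratio is its power sum of order \<open>q\<close>; in this form different exponents can be
  compared.\<close>

lemma R_ratio_eq:
  assumes "\<forall>j\<in>{1..n}. d j > 0"
  shows "R_ratio q n d = (\<Sum>j=1..n. (unit_weight d n j)\<^sup>2 powr q)"
  unfolding R_ratio_def sum_divide_distrib
proof (rule sum.cong[OF refl])
  fix j assume j: "j \<in> {1..n}"
  have "d j powr (2 * q) = (d j)\<^sup>2 powr q"
    using bspec[OF assms j] by (simp add: powr_powr[symmetric])
  then show "d j powr (2 * q) / (\<Sum>j=1..n. (d j)\<^sup>2) powr q = (unit_weight d n j)\<^sup>2 powr q"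
    by (simp add: unit_weight_def power_divide sum_nonneg powr_divide)
qed

lemma R_ratio_2_eq:
  assumes "\<forall>j\<in>{1..n}. d j > 0"
  shows "R_ratio 2 n d = (\<Sum>j=1..n. unit_weight d n j ^ 4)"
  unfolding R_ratio_eq[OF assms] by (intro sum.cong) (auto simp: power_mult[symmetric])

text \<open>Since the squared unit weights sum to 1, the quantity on the left is at most their maximum.\<close>

lemma R_ratio_2_le:
  assumes d: "\<forall>j\<in>{1..n}. d j > 0" and "q > 1"
  shows "R_ratio 2 n d \<le> R_ratio q n d powr (1 / q)"
proof (cases "n = 0")
  case True
  then show ?thesis by (simp add: R_ratio_def)
next
  case False
  define a where "a = unit_weight d n"
  have le: "(a j)\<^sup>2 \<le> R_ratio q n d powr (1 / q)" if "j \<in> {1..n}" for j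
  proof -
    have "(a j)\<^sup>2 powr q \<le> R_ratio q n d"
      unfolding R_ratio_eq[OF d] a_def by (rule member_le_sum[OF that]) auto
    then have "((a j)\<^sup>2 powr q) powr (1 / q) \<le> R_ratio q n d powr (1 / q)"
      using \<open>q > 1\<close> by (intro powr_mono2) auto
    then show ?thesis
      using \<open>q > 1\<close> by (simp add: powr_powr)
  qed
  have "(\<Sum>j=1..n. a j ^ 4) \<le> (\<Sum>j=1..n. R_ratio q n d powr (1 / q) * (a j)\<^sup>2)"
  proof (rule sum_mono)
    fix j assume "j \<in> {1..n}"
    from mult_right_mono[OF le[OF this], of "(a j)\<^sup>2"]
    show "a j ^ 4 \<le> R_ratio q n d powr (1 / q) * (a j)\<^sup>2"
      by (simp flip: power_add)
  qed
  also have "\<dots> = R_ratio q n d powr (1 / q)"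
    using sum_unit_weight_square[OF d] False by (simp add: a_def flip: sum_distrib_left)
  finally show ?thesis
    by (simp add: R_ratio_2_eq[OF d] a_def)
qed

lemma R_ratio_nonneg: "R_ratio q n d \<ge> 0"
  by (simp add: R_ratio_def sum_nonneg)

theorem theorem2:
  fixes E :: "nat \<Rightarrow> nat \<Rightarrow> real" and d :: "nat \<Rightarrow> nat \<Rightarrow> real"
  assumes indep: "\<And>n c. (\<Sum>j=1..n. of_rat (c j) * E n j) = 0 \<Longrightarrow> (\<forall>j\<in>{1..n}. c j = 0)"
    and pos: "\<And>n j. j \<in> {1..n} \<Longrightarrow> d n j > 0"
  shows "(\<exists>q>1. (\<lambda>n. R_ratio q n (d n)) \<longlonglongrightarrow> 0) \<longleftrightarrow>
         conv_dist_time_avg (\<lambda>n t. Ysig (d n) (E n) n t) std_gauss2"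
proof
  have E: "int_indep (E n) {1..n}" for n
    unfolding int_indep_def
  proof (intro allI impI)
    fix c :: "nat \<Rightarrow> int"
    assume "(\<Sum>j=1..n. of_int (c j) * E n j) = 0"
    then show "\<forall>j\<in>{1..n}. c j = 0"
      using indep[of "\<lambda>j. of_int (c j)" n] by simp
  qed
  have pos': "\<forall>j\<in>{1..n}. d n j > 0" for n
    using pos by blast
  have R2: "R_ratio 2 n (d n) = (\<Sum>j=1..n. unit_weight (d n) n j ^ 4)" for n
    by (rule R_ratio_2_eq[OF pos'])
  have Y: "Ysig (d n) (E n) n \<in> ap UNIV" for n
    unfolding Ysig_eq by (rule wave_sum_ap)
  {
    assume "\<exists>q>1. (\<lambda>n. R_ratio q n (d n)) \<longlonglongrightarrow> 0"
    then obtain q where q: "q > 1" "(\<lambda>n. R_ratio q n (d n)) \<longlonglongrightarrow> 0"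
      by blast
    have powr_lim: "(\<lambda>n. R_ratio q n (d n) powr (1 / q)) \<longlonglongrightarrow> 0"
      using q by (intro tendsto_zero_powrI[OF q(2) tendsto_const]) (auto simp: R_ratio_nonneg)
    have R2_lim: "(\<lambda>n. R_ratio 2 n (d n)) \<longlonglongrightarrow> 0"
      by (rule tendsto_sandwich[OF _ _ tendsto_const powr_lim])
         (auto simp: R_ratio_nonneg R_ratio_2_le[OF pos' q(1)])
    show "conv_dist_time_avg (\<lambda>n t. Ysig (d n) (E n) n t) std_gauss2"
    proof (rule conv_dist_time_avgI[OF prob_space_std_gauss2 sets_std_gauss2 Y, where C = 1])
      fix n
      show "Re (mean (\<lambda>t. of_real ((norm (Ysig (d n) (E n) n t))\<^sup>2))) \<le> 1"
        \<comment> \<open>The second moment is exactly 1 for positive \<open>n\<close>. For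
          \<open>n = 0\<close> the signal is an empty sum and the moment is 0, hence an
          inequality.\<close>
        unfolding Ysig_eq mean_norm_wave_sum[OF E finite_atLeastAtMost]
        using sum_unit_weight_square[OF pos', of n] by (cases "n = 0") auto
    next
      fix u :: complex
      define r where "r = (norm u)\<^sup>2 / 4"
      have char_bound: "\<forall>\<^sub>F n in sequentially. norm (mean (\<lambda>t. iexp (u \<bullet> Ysig (d n) (E n) n t)) - exp (- r))
          \<le> r\<^sup>2 * (1 + r) * R_ratio 2 n (d n)"
        using eventually_gt_at_top[of 0]
      proof eventually_elim
        case (elim n)
        show ?case
          unfolding Ysig_eq R2 r_def
          by (rule norm_char_wave_sum_diff_le[OF E finite_atLeastAtMost sum_unit_weight_square[OF pos' elim]])
      qed
      have bound_lim: "(\<lambda>n. r\<^sup>2 * (1 + r) * R_ratio 2 n (d n)) \<longlonglongrightarrow> 0"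
        using tendsto_mult_left[OF R2_lim, of "r\<^sup>2 * (1 + r)"] by simp
      have "(\<lambda>n. mean (\<lambda>t. iexp (u \<bullet> Ysig (d n) (E n) n t))) \<longlonglongrightarrow> exp (- r)"
        by (rule LIM_zero_cancel[OF Lim_null_comparison[OF char_bound bound_lim]])
      then show "(\<lambda>n. mean (\<lambda>t. iexp (u \<bullet> Ysig (d n) (E n) n t))) \<longlonglongrightarrow> integral\<^sup>L std_gauss2 (\<lambda>y. iexp (u \<bullet> y))"
        by (simp add: integral_iexp_std_gauss2 r_def)
    qed
  }
  {
    assume conv: "conv_dist_time_avg (\<lambda>n t. Ysig (d n) (E n) n t) std_gauss2"
    \<comment> \<open>One test function suffices: cos(Re y) is the real part of the wave at
      \<open>u = 1\<close>, so \<open>b\<close> is the real part of the characteristic function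
      there.\<close>
    define b where "b n = Re (mean (\<lambda>t. complex_of_real (cos (Re (Ysig (d n) (E n) n t)))))" for n
    have "b \<longlonglongrightarrow> integral\<^sup>L std_gauss2 (\<lambda>y. cos (Re y))"
      unfolding b_def
      by (rule conv_dist_time_avgD[OF conv Y, where g = "\<lambda>y. cos (Re y)"])
         (auto intro!: continuous_intros boundedI[of _ 1])
    also have "integral\<^sup>L std_gauss2 (\<lambda>y. cos (Re y)) = exp (- 1 / 4)"
    proof -
      have "integrable std_gauss2 (\<lambda>y. iexp (1 \<bullet> y))"
        by (rule integrable_ap[OF prob_space_std_gauss2 sets_std_gauss2 ap.wave[OF UNIV_I]])
      from integral_Re[OF this] have
        "integral\<^sup>L std_gauss2 (\<lambda>y. Re (iexp (1 \<bullet> y))) = exp (- (cmod 1)\<^sup>2 / 4)"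
        by (simp only: integral_iexp_std_gauss2 Re_complex_of_real)
      moreover have "Re (iexp (1 \<bullet> y)) = cos (Re y)" for y
        by (simp add: cis_conv_exp[symmetric] inner_complex_def)
      ultimately show ?thesis
        by simp
    qed
    finally have "(\<lambda>n. b n / exp (- 1 / 4)) \<longlonglongrightarrow> exp (- 1 / 4) / exp (- 1 / 4)"
      by (intro tendsto_divide tendsto_const) auto
    then have lim: "(\<lambda>n. b n / exp (- 1 / 4)) \<longlonglongrightarrow> 1"
      by simp
    have "(\<lambda>n. - 128 * ln (b n / exp (- 1 / 4))) \<longlonglongrightarrow> - 128 * ln 1"
      by (intro tendsto_mult tendsto_const tendsto_ln lim) simp
    then have bound_lim: "(\<lambda>n. - 128 * ln (b n / exp (- 1 / 4))) \<longlonglongrightarrow> 0"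
      by simp
    \<comment> \<open>Solving \<open>b n\<close> \<le> exp(-1/4 - R/128) for the fourth-power ratio
      R. The logarithm requires \<open>b n\<close> positive, which holds eventually because the
      quotient tends to 1.\<close>
    have bound: "\<forall>\<^sub>F n in sequentially. R_ratio 2 n (d n) \<le> - 128 * ln (b n / exp (- 1 / 4))"
      using order_tendstoD(1)[OF lim zero_less_one] eventually_gt_at_top[of 0]
    proof eventually_elim
      case (elim n)
      define F where "F t = iexp (1 \<bullet> Ysig (d n) (E n) n t)" for t
      have "(\<lambda>t. complex_of_real (1 \<bullet> Ysig (d n) (E n) n t)) \<in> ap UNIV"
        by (rule ap_compose_complex[OF _ Y]) (intro continuous_intros)
      then have F: "F \<in> ap UNIV"
        unfolding F_def by (intro ap_iexp) auto
      have "Re (F t) = cos (Re (Ysig (d n) (E n) n t))" for t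
        by (simp add: F_def cis_conv_exp[symmetric] inner_complex_def)
      then have "b n = Re (mean F)"
        using mean_Re[OF F] by (simp add: b_def)
      also have "\<dots> \<le> norm (mean F)"
        by (rule complex_Re_le_cmod)
      also have "\<dots> \<le> exp (- 1 / 4 - R_ratio 2 n (d n) / 128)"
        unfolding F_def Ysig_eq R2
        by (rule norm_char_wave_sum_le[OF E finite_atLeastAtMost sum_unit_weight_square[OF pos' elim(2)]])
      also have "\<dots> = exp (- (R_ratio 2 n (d n) / 128)) * exp (- 1 / 4)"
        by (simp add: exp_add[symmetric])
      finally have "b n / exp (- 1 / 4) \<le> exp (- (R_ratio 2 n (d n) / 128))"
        by (simp only: pos_divide_le_eq[OF exp_gt_zero])
      then have "ln (b n / exp (- 1 / 4)) \<le> ln (exp (- (R_ratio 2 n (d n) / 128)))"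
        using elim(1) by (subst ln_le_cancel_iff) auto
      then show ?case
        unfolding ln_exp by linarith
    qed
    have "(\<lambda>n. R_ratio 2 n (d n)) \<longlonglongrightarrow> 0"
      by (rule tendsto_sandwich[OF _ bound tendsto_const bound_lim]) (simp add: R_ratio_nonneg)
    \<comment> \<open>Convergence thus forces the condition at \<open>q = 2\<close>; the absence of
      any suitable exponent rules it out.\<close>
    then show "\<exists>q>1. (\<lambda>n. R_ratio q n (d n)) \<longlonglongrightarrow> 0"
      by (intro exI[of _ 2]) auto
  }
qed

end
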